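(* Let $X=(X_t)_{t\in[0,T]}$ be a zero-mean continuous Gaussian process with $X_0=0$, whose law on $C_0([0,T])$ has full support and which has a covariance measure $\mu$. Let $h\in L_\mu$ and $F\in Cyl$. Then $$E\big(\langle DF,h\rangle_{\mathcal H}\big)=E\Big(F\int_0^Th\,dX\Big).$$
   Context: Fix $T>0$. $C_0([0,T])$ is the space of continuous functions on $[0,T]$ vanishing at $0$. Let $R(s,t)=\mathrm{Cov}(X_s,X_t)$. For $I=]a_1,b_1]\times]a_2,b_2]\subset[0,T]^2$ put $\Delta_IR=R(b_1,b_2)+R(a_1,a_2)-R(a_1,b_2)-R(b_1,a_2)$. $X$ has covariance measure $\mu$ if $I\mapsto\Delta_IR$ extends to a signed ($\sigma$-finite) measure $\mu$ on $\mathcal{B}([0,T]^2)$; thus $\mu([0,s]\times[0,t])=R(s,t)$. $L_\mu$ is the space of Borel $\varphi:[0,T]\to\mathbb{R}$ with $\int_{[0,T]^2}|\varphi(u)||\varphi(v)|\,d|\mu|(u,v)<\infty$, with semiscalar product $\langle\varphi,\phi\rangle_{\mathcal H}=\int_{[0,T]^2}\varphi(u)\phi(v)\,d\mu(u,v)$ and seminorm $\|\cdot\|_{\mathcal H}$. The Wiener integral $\varphi\mapsto\int_0^T\varphi\,dX$ is the linear map $L_\mu\to L^2(\Omega)$, continuous for $\|\cdot\|_{\mathcal H}$, with $\int1_{[0,t]}dX=X_t$; it satisfies $E(\int_0^T\varphi dX)^2=\|\varphi\|_{\mathcal H}^2$. $Cyl$ is the set of random variables $F=f(\int\phi_1dX,\dots,\int\phi_ndX)$,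 $n\ge1$, $f\in C_b^\infty(\mathbb{R}^n)$ (smooth, bounded with all derivatives), $\phi_i\in L_\mu$, and $DF=\sum_i\partial_if(\int\phi_1dX,\dots,\int\phi_ndX)\phi_i$.
   Formalization: It is additionally assumed that L_μ is closed under linear combinations (so that ⟨φ,ψ⟩_H converges for all φ,ψ in L_μ); this can fail for a covariance measure of varying sign, and then the semiscalar product and the linear Wiener integral on L_μ are not defined. *)

theory Defs
  imports "HOL-Probability.Probability"
begin

section \<open>Gaussian processes and their law on path space\<close>

text \<open>Degenerate Gaussian variables (almost surely constant ones) are included.\<close>

definition gaussian_rv :: "'a measure \<Rightarrow> ('a \<Rightarrow> real) \<Rightarrow> bool" where
  "gaussian_rv M Y \<longleftrightarrow> Y \<in> borel_measurable M \<and>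
     (\<exists>m \<sigma>. (\<sigma> = 0 \<and> (AE \<omega> in M. Y \<omega> = m)) \<or>
            (\<sigma> > 0 \<and> distributed M lborel Y (normal_density m \<sigma>)))"

definition gaussian_process :: "'a measure \<Rightarrow> real set \<Rightarrow> (real \<Rightarrow> 'a \<Rightarrow> real) \<Rightarrow> bool" where
  "gaussian_process M I X \<longleftrightarrow>
     (\<forall>t\<in>I. X t \<in> borel_measurable M) \<and>
     (\<forall>J c. finite J \<longrightarrow> J \<subseteq> I \<longrightarrow> gaussian_rv M (\<lambda>\<omega>. \<Sum>t\<in>J. c t * X t \<omega>))"

text \<open>Elements of \<open>C\<^sub>0([0,T])\<close> are represented by functions that are \<open>undefined\<close> outside
  \<open>[0,T]\<close>. The supremum distance is set to \<open>0\<close> off the carrier because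
  \<^locale>\<open>Metric_space\<close> constrains the distance function on the whole type.\<close>

definition C0 :: "real \<Rightarrow> (real \<Rightarrow> real) set" where
  "C0 T = {g \<in> extensional {0..T}. continuous_on {0..T} g \<and> g 0 = 0}"

definition C0_dist :: "real \<Rightarrow> (real \<Rightarrow> real) \<Rightarrow> (real \<Rightarrow> real) \<Rightarrow> real" where
  "C0_dist T f g = (if f \<in> C0 T \<and> g \<in> C0 T then SUP t\<in>{0..T}. \<bar>f t - g t\<bar> else 0)"

abbreviation C0_topology :: "real \<Rightarrow> (real \<Rightarrow> real) topology" where
  "C0_topology T \<equiv> Metric_space.mtopology (C0 T) (C0_dist T)"

lemma Metric_space_C0:
  assumes "0 \<le> T"
  shows "Metric_space (C0 T) (C0_dist T)"
proof -
  have bdd: "bdd_above ((\<lambda>t. \<bar>f t - g t\<bar>) ` {0..T})" if "f \<in> C0 T" "g \<in> C0 T" for f g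
  proof -
    have "compact ((\<lambda>t. \<bar>f t - g t\<bar>) ` {0..T})"
      using that by (intro compact_continuous_image continuous_intros) (auto simp: C0_def)
    then show ?thesis
      by (intro bounded_imp_bdd_above compact_imp_bounded)
  qed
  have upper: "\<bar>f t - g t\<bar> \<le> C0_dist T f g"
    if "f \<in> C0 T" "g \<in> C0 T" "t \<in> {0..T}" for f g t
    using that bdd[OF that(1,2)] by (auto simp: C0_dist_def intro: cSUP_upper)
  have least: "C0_dist T f g \<le> c"
    if "f \<in> C0 T" "g \<in> C0 T" "\<And>t. t \<in> {0..T} \<Longrightarrow> \<bar>f t - g t\<bar> \<le> c" for f g c
    using that assms by (auto simp: C0_dist_def intro!: cSUP_least)
  have nonneg: "0 \<le> C0_dist T f g" for f g
  proof (cases "f \<in> C0 T \<and> g \<in> C0 T")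
    case True
    then show ?thesis using upper[of f g 0] assms by force
  qed (auto simp: C0_dist_def)
  show ?thesis
  proof
    show "0 \<le> C0_dist T f g" for f g by (rule nonneg)
    show "C0_dist T f g = C0_dist T g f" for f g
      by (simp add: C0_dist_def abs_minus_commute)
    show "(C0_dist T f g = 0) = (f = g)" if fg: "f \<in> C0 T" "g \<in> C0 T" for f g
    proof
      assume "C0_dist T f g = 0"
      then have "f t = g t" if "t \<in> {0..T}" for t
        using upper[OF fg that] by simp
      then show "f = g"
        using fg by (intro extensionalityI[of _ "{0..T}"]) (auto simp: C0_def)
    next
      assume "f = g"
      then have "C0_dist T f g \<le> 0" using fg by (intro least) auto
      with nonneg[of f g] show "C0_dist T f g = 0" by simp
    qed
    show "C0_dist T f k \<le> C0_dist T f g + C0_dist T g k"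
      if "f \<in> C0 T" "g \<in> C0 T" "k \<in> C0 T" for f g k
    proof (rule least[OF that(1,3)])
      fix t assume t: "t \<in> {0..T}"
      show "\<bar>f t - k t\<bar> \<le> C0_dist T f g + C0_dist T g k"
        using upper[OF that(1,2) t] upper[OF that(2,3) t] by linarith
    qed
  qed
qed

definition C0_law :: "'a measure \<Rightarrow> real \<Rightarrow> (real \<Rightarrow> 'a \<Rightarrow> real) \<Rightarrow> (real \<Rightarrow> real) measure" where
  "C0_law M T X =
     distr M (sigma (C0 T) {U. openin (C0_topology T) U}) (\<lambda>\<omega>. restrict (\<lambda>t. X t \<omega>) {0..T})"

definition full_support_C0 :: "'a measure \<Rightarrow> real \<Rightarrow> (real \<Rightarrow> 'a \<Rightarrow> real) \<Rightarrow> bool" where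
  "full_support_C0 M T X \<longleftrightarrow>
     (\<forall>U. openin (C0_topology T) U \<longrightarrow> U \<noteq> {} \<longrightarrow> emeasure (C0_law M T X) U > 0)"


section \<open>Signed measures\<close>

text \<open>In this section \<open>N\<close> only serves as a measurable space.\<close>

definition signed_measure :: "'b measure \<Rightarrow> ('b set \<Rightarrow> ereal) \<Rightarrow> bool" where
  "signed_measure N \<mu> \<longleftrightarrow>
     \<mu> {} = 0 \<and>
     ((\<forall>A\<in>sets N. \<mu> A \<noteq> \<infinity>) \<or> (\<forall>A\<in>sets N. \<mu> A \<noteq> -\<infinity>)) \<and>
     (\<forall>A :: nat \<Rightarrow> 'b set. range A \<subseteq> sets N \<longrightarrow> disjoint_family A \<longrightarrow>
        (\<lambda>i. \<mu> (A i)) sums \<mu> (\<Union>i. A i))"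

definition sigma_finite_signed_measure :: "'b measure \<Rightarrow> ('b set \<Rightarrow> ereal) \<Rightarrow> bool" where
  "sigma_finite_signed_measure N \<mu> \<longleftrightarrow> signed_measure N \<mu> \<and>
     (\<exists>A :: nat \<Rightarrow> 'b set. range A \<subseteq> sets N \<and> (\<Union>i. A i) = space N \<and> (\<forall>i. \<bar>\<mu> (A i)\<bar> \<noteq> \<infinity>))"

text \<open>Jordan decomposition: \<open>\<mu>\<^sup>+(A)\<close> is the supremum of \<open>\<mu>(B)\<close> over measurable \<open>B \<subseteq> A\<close>
  (negative values are cut off by \<^const>\<open>e2ennreal\<close>, which is harmless as \<open>B = {}\<close> is allowed),
  \<open>\<mu>\<^sup>- = (-\<mu>)\<^sup>+\<close>, and \<open>\<bar>\<mu>\<bar> = \<mu>\<^sup>+ + \<mu>\<^sup>-\<close>.\<close>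

definition pos_variation :: "'b measure \<Rightarrow> ('b set \<Rightarrow> ereal) \<Rightarrow> 'b measure" where
  "pos_variation N \<mu> =
     measure_of (space N) (sets N) (\<lambda>A. SUP B\<in>{B \<in> sets N. B \<subseteq> A}. e2ennreal (\<mu> B))"

definition neg_variation :: "'b measure \<Rightarrow> ('b set \<Rightarrow> ereal) \<Rightarrow> 'b measure" where
  "neg_variation N \<mu> = pos_variation N (\<lambda>A. - \<mu> A)"

definition total_variation :: "'b measure \<Rightarrow> ('b set \<Rightarrow> ereal) \<Rightarrow> 'b measure" where
  "total_variation N \<mu> = measure_of (space N) (sets N)
     (\<lambda>A. emeasure (pos_variation N \<mu>) A + emeasure (neg_variation N \<mu>) A)"

definition signed_integral :: "'b measure \<Rightarrow> ('b set \<Rightarrow> ereal) \<Rightarrow> ('b \<Rightarrow> real) \<Rightarrow> real" where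
  "signed_integral N \<mu> f =
     integral\<^sup>L (pos_variation N \<mu>) f - integral\<^sup>L (neg_variation N \<mu>) f"


section \<open>Covariance measures\<close>

definition covariance :: "'a measure \<Rightarrow> ('a \<Rightarrow> real) \<Rightarrow> ('a \<Rightarrow> real) \<Rightarrow> real" where
  "covariance M Y Z =
     integral\<^sup>L M (\<lambda>\<omega>. (Y \<omega> - integral\<^sup>L M Y) * (Z \<omega> - integral\<^sup>L M Z))"

definition rect_increment :: "(real \<Rightarrow> real \<Rightarrow> real) \<Rightarrow> real \<Rightarrow> real \<Rightarrow> real \<Rightarrow> real \<Rightarrow> real" where
  "rect_increment R a1 b1 a2 b2 = R b1 b2 + R a1 a2 - R a1 b2 - R b1 a2"

abbreviation square_borel :: "real \<Rightarrow> (real \<times> real) measure" where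
  "square_borel T \<equiv> restrict_space borel ({0..T} \<times> {0..T})"

text \<open>The half-open rectangles contained in \<open>[0,T]\<^sup>2\<close> do not meet the axes. The last clause
  fixes the measure there: since \<open>R(0,t) = 0\<close> for a process started at \<open>0\<close>, it says that the
  axes carry no mass.\<close>

definition is_covariance_measure ::
  "'a measure \<Rightarrow> real \<Rightarrow> (real \<Rightarrow> 'a \<Rightarrow> real) \<Rightarrow> ((real \<times> real) set \<Rightarrow> ereal) \<Rightarrow> bool" where
  "is_covariance_measure M T X \<mu> \<longleftrightarrow>
     sigma_finite_signed_measure (square_borel T) \<mu> \<and>
     (\<forall>a1 b1 a2 b2. 0 \<le> a1 \<and> a1 \<le> b1 \<and> b1 \<le> T \<and> 0 \<le> a2 \<and> a2 \<le> b2 \<and> b2 \<le> T \<longrightarrow>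
        \<mu> ({a1<..b1} \<times> {a2<..b2})
          = ereal (rect_increment (\<lambda>s t. covariance M (X s) (X t)) a1 b1 a2 b2)) \<and>
     (\<forall>s\<in>{0..T}. \<forall>t\<in>{0..T}. \<mu> ({0..s} \<times> {0..t}) = ereal (covariance M (X s) (X t)))"

text \<open>Functions on \<open>[0,T]\<close> are represented by functions on the reals whose values outside
  \<open>[0,T]\<close> are irrelevant.\<close>

definition L_space :: "real \<Rightarrow> ((real \<times> real) set \<Rightarrow> ereal) \<Rightarrow> (real \<Rightarrow> real) set" where
  "L_space T \<mu> = {\<phi> \<in> borel_measurable (restrict_space borel {0..T}).
     (\<integral>\<^sup>+ (u, v). ennreal (\<bar>\<phi> u\<bar> * \<bar>\<phi> v\<bar>) \<partial>total_variation (square_borel T) \<mu>) < \<infinity>}"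

definition H_inner ::
  "real \<Rightarrow> ((real \<times> real) set \<Rightarrow> ereal) \<Rightarrow> (real \<Rightarrow> real) \<Rightarrow> (real \<Rightarrow> real) \<Rightarrow> real" where
  "H_inner T \<mu> \<phi> \<psi> = signed_integral (square_borel T) \<mu> (\<lambda>(u, v). \<phi> u * \<psi> v)"

definition H_norm :: "real \<Rightarrow> ((real \<times> real) set \<Rightarrow> ereal) \<Rightarrow> (real \<Rightarrow> real) \<Rightarrow> real" where
  "H_norm T \<mu> \<phi> = sqrt (H_inner T \<mu> \<phi> \<phi>)"

text \<open>Finiteness of the integral defining \<^const>\<open>L_space\<close> for \<open>\<phi>\<close> and for \<open>\<psi>\<close> does not by itself
  make \<open>\<phi>(u) \<psi>(v)\<close> integrable for \<open>\<bar>\<mu>\<bar>\<close>, because \<open>\<bar>\<mu>\<bar>\<close> need not be positive semidefinite.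
  That \<^const>\<open>H_inner\<close> is a well-defined form on a linear space is equivalent to the following
  closure property (apply it to \<open>\<bar>\<phi>\<bar>\<close> and \<open>\<bar>\<psi>\<bar>\<close>).\<close>

definition L_space_linear :: "real \<Rightarrow> ((real \<times> real) set \<Rightarrow> ereal) \<Rightarrow> bool" where
  "L_space_linear T \<mu> \<longleftrightarrow>
     (\<forall>\<phi>\<in>L_space T \<mu>. \<forall>\<psi>\<in>L_space T \<mu>. \<forall>a b. (\<lambda>u. a * \<phi> u + b * \<psi> u) \<in> L_space T \<mu>)"


section \<open>Wiener integral\<close>

definition L2_norm_rv :: "'a measure \<Rightarrow> ('a \<Rightarrow> real) \<Rightarrow> real" where
  "L2_norm_rv M Y = sqrt (integral\<^sup>L M (\<lambda>\<omega>. (Y \<omega>)\<^sup>2))"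

text \<open>\<open>W \<phi>\<close> is a version of the Wiener integral of \<open>\<phi>\<close>, for every \<open>\<phi>\<close>: elements of
  \<open>L\<^sup>2(\<Omega>)\<close> are represented by square integrable functions and identities between them hold
  almost surely.\<close>

definition is_wiener_integral ::
  "'a measure \<Rightarrow> real \<Rightarrow> (real \<Rightarrow> 'a \<Rightarrow> real) \<Rightarrow> ((real \<times> real) set \<Rightarrow> ereal) \<Rightarrow>
     ((real \<Rightarrow> real) \<Rightarrow> 'a \<Rightarrow> real) \<Rightarrow> bool" where
  "is_wiener_integral M T X \<mu> W \<longleftrightarrow>
     (\<forall>\<phi>\<in>L_space T \<mu>. W \<phi> \<in> borel_measurable M \<and> integrable M (\<lambda>\<omega>. (W \<phi> \<omega>)\<^sup>2)) \<and>
     (\<forall>\<phi>\<in>L_space T \<mu>. \<forall>\<psi>\<in>L_space T \<mu>. \<forall>a b.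
        AE \<omega> in M. W (\<lambda>u. a * \<phi> u + b * \<psi> u) \<omega> = a * W \<phi> \<omega> + b * W \<psi> \<omega>) \<and>
     (\<forall>\<phi>\<in>L_space T \<mu>. \<forall>\<epsilon>>0. \<exists>\<delta>>0. \<forall>\<psi>\<in>L_space T \<mu>.
        H_norm T \<mu> (\<lambda>u. \<psi> u - \<phi> u) < \<delta> \<longrightarrow> L2_norm_rv M (\<lambda>\<omega>. W \<psi> \<omega> - W \<phi> \<omega>) < \<epsilon>) \<and>
     (\<forall>t\<in>{0..T}. AE \<omega> in M. W (indicator {0..t}) \<omega> = X t \<omega>)"


section \<open>Cylindrical random variables and their derivative\<close>

definition pderiv_at :: "'n::finite \<Rightarrow> (real^'n \<Rightarrow> real) \<Rightarrow> real^'n \<Rightarrow> real" where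
  "pderiv_at i f x = frechet_derivative f (at x) (axis i 1)"

text \<open>Smooth functions bounded together with all their derivatives: every iterated partial
  derivative is everywhere differentiable (so that the next ones exist and all are continuous)
  and bounded.\<close>

definition Cb_infinity :: "(real^'n::finite \<Rightarrow> real) set" where
  "Cb_infinity = {f. \<forall>js :: 'n list.
     (\<forall>x. foldr pderiv_at js f differentiable (at x)) \<and> bounded (range (foldr pderiv_at js f))}"

text \<open>The type \<open>'n\<close> is the index set of the integrands \<open>\<phi>\<^sub>1, \<dots>, \<phi>\<^sub>n\<close>. The derivative at \<open>\<omega>\<close> is a
  function on \<open>[0,T]\<close>. It is attached to the representation \<open>(f, \<phi>)\<close>.\<close>

definition cyl_rv ::
  "((real \<Rightarrow> real) \<Rightarrow> 'a \<Rightarrow> real) \<Rightarrow> (real^'n::finite \<Rightarrow> real) \<Rightarrow> ('n \<Rightarrow> real \<Rightarrow> real) \<Rightarrow> 'a \<Rightarrow> real" where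
  "cyl_rv W f \<phi> \<omega> = f (\<chi> i. W (\<phi> i) \<omega>)"

definition cyl_deriv ::
  "((real \<Rightarrow> real) \<Rightarrow> 'a \<Rightarrow> real) \<Rightarrow> (real^'n::finite \<Rightarrow> real) \<Rightarrow> ('n \<Rightarrow> real \<Rightarrow> real) \<Rightarrow>
     'a \<Rightarrow> real \<Rightarrow> real" where
  "cyl_deriv W f \<phi> \<omega> u = (\<Sum>i\<in>UNIV. pderiv_at i f (\<chi> j. W (\<phi> j) \<omega>) * \<phi> i u)"

end

theory Submission
  imports Defs
begin

text \<open>Every Wiener integral lies in the closed linear span of the \<open>X\<^sub>t\<close> in \<open>L\<^sup>2(\<Omega>)\<close>, and the Wiener
  integral is isometric: both properties hold for indicators of \<open>[0,t]\<close> and survive linear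
  combinations and dominated limits, which exhaust \<open>L\<^sub>\<mu>\<close>. Hence the vector of the
  \<open>\<integral>\<phi>\<^sub>i dX\<close> together with \<open>Z = \<integral>h dX\<close> is centred Gaussian with covariances
  given by the form on \<open>L\<^sub>\<mu>\<close>, and the claim becomes Gaussian integration by parts,
  \<open>E (f(Y) Z) = \<Sum>\<^sub>i E (Y\<^sub>i Z) E (\<partial>\<^sub>i f(Y))\<close>.\<close>

section \<open>Uniqueness of characteristic functions\<close>

text \<open>The vector Y of the Wiener integrals need not have a density, since its integrands may
  be linearly dependent for the seminorm. Integration by parts therefore takes place on the line,
  along Z, once the part of Y correlated with Z has been split off; only a vanishing variance of Z
  needs separate care. Independence of the remainder and Z is read off characteristic functions,
  which calls for their uniqueness in several dimensions. On the side of the integrands there are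
  two obstacles. The Wiener integral is assumed continuous, not isometric. And integrability of
  \<phi>(u) \<phi>(v) and of \<psi>(u) \<psi>(v) for the total variation does not control \<phi>(u)
  \<psi>(v). Limits are therefore taken pointwise under a dominating function g in the space: g(u)
  g(v) is then an integrable bound, so dominated convergence controls the form, hence the seminorm,
  hence by continuity the Wiener integral.\<close>

lemma weighted_distr_unique:
  fixes w X :: "'b \<Rightarrow> real" and g :: "real \<Rightarrow> real"
  assumes M: "finite_measure M" and N: "finite_measure N" and sets: "sets M = sets N"
    and [measurable]: "w \<in> borel_measurable M" "X \<in> borel_measurable M" "g \<in> borel_measurable borel"
    and w: "\<And>x. 0 \<le> w x" "\<And>x. w x \<le> B"
    and eq: "\<And>s \<theta>. (\<integral>x. w x * cos (s * X x + \<theta>) \<partial>M) = (\<integral>x. w x * cos (s * X x + \<theta>) \<partial>N)"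
  shows "(\<integral>x. w x * g (X x) \<partial>M) = (\<integral>x. w x * g (X x) \<partial>N)"
proof -
  interpret M: finite_measure M by fact
  interpret N: finite_measure N by fact
  note sets[measurable_cong]
  have meas[measurable]: "w \<in> borel_measurable N" "X \<in> borel_measurable N"
    using sets by (auto cong: measurable_cong_sets)
  define c where "c = (\<integral>x. w x \<partial>M)"
  \<comment> \<open>Frequency and phase zero: both measures give \<open>w\<close> the same mass, so
    one constant normalises both.\<close>
  have cN: "c = (\<integral>x. w x \<partial>N)" using eq[of 0 0] by (simp add: c_def)
  have iM: "integrable M w" by (rule M.integrable_const_bound[of _ B]) (use w in auto)
  have iN: "integrable N w" by (rule N.integrable_const_bound[of _ B]) (use w in auto)
  have c0: "0 \<le> c" using w by (simp add: c_def)
  show ?thesis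
  proof (cases "c = 0")
    case True
    have "AE x in M. w x = 0" "AE x in N. w x = 0"
      using True cN w integral_nonneg_eq_0_iff_AE[OF iM] integral_nonneg_eq_0_iff_AE[OF iN] 
      unfolding c_def by auto
    then have "(\<integral>x. w x * g (X x) \<partial>M) = 0" "(\<integral>x. w x * g (X x) \<partial>N) = 0"
      by (auto intro!: integral_eq_zero_AE)
    then show ?thesis by simp
  next
    case False
    with c0 have c: "0 < c" by simp
    \<comment> \<open>This is the law of \<open>X\<close> under the probability measure with density
      \<open>w / c\<close>. The phases 0 and -pi/2 turn the cosine integrals of the hypothesis into
      the real and imaginary parts of its characteristic function.\<close>
    define D where "D P = distr (density P (\<lambda>x. ennreal (w x / c))) borel X" for P :: "'b measure"
    have D: "real_distribution (D P) \<and>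
        (\<forall>k \<in> borel_measurable borel. (\<integral>x. k x \<partial>D P) = (\<integral>x. w x * k (X x) \<partial>P) / c) \<and>
        (\<forall>s. char (D P) s = complex_of_real ((\<integral>x. w x * cos (s * X x + 0) \<partial>P) / c)
            + \<i> * complex_of_real ((\<integral>x. w x * cos (s * X x + (- pi/2)) \<partial>P) / c))"
      if P: "finite_measure P" and sP: "sets P = sets M" and cP: "c = (\<integral>x. w x \<partial>P)" for P
    proof -
      interpret P: finite_measure P by fact
      note sP[measurable_cong]
      have [measurable]: "w \<in> borel_measurable P" "X \<in> borel_measurable P"
        using sP by (auto cong: measurable_cong_sets)
      have iP: "integrable P w" by (rule P.integrable_const_bound[of _ B]) (use w in auto)
      have "emeasure (D P) (space (D P)) = (\<integral>\<^sup>+ x. ennreal (w x / c) \<partial>P)"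
        by (simp add: D_def emeasure_distr emeasure_density cong: nn_integral_cong)
      also have "\<dots> = ennreal (\<integral>x. w x / c \<partial>P)"
        using iP w c by (intro nn_integral_eq_integral) auto
      also have "\<dots> = 1" using c cP by simp
      finally have 1: "real_distribution (D P)"
        by (auto simp: real_distribution_def real_distribution_axioms_def D_def intro!: prob_spaceI)
      have 2: "(\<integral>x. k x \<partial>D P) = (\<integral>x. w x * k (X x) \<partial>P) / c"
        if [measurable]: "k \<in> borel_measurable borel" for k :: "real \<Rightarrow> real"
        unfolding D_def using w c by (simp add: integral_distr integral_density)
      interpret D: real_distribution "D P" by (rule 1)
      have "char (D P) s = complex_of_real (\<integral>x. cos (s * x) \<partial>D P) + \<i> * complex_of_real (\<integral>x. sin (s * x) \<partial>D P)" for s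
      proof (rule complex_eqI)
        have i: "integrable (D P) (\<lambda>x. iexp (s * x))" 
          by (rule D.integrable_iexp) auto
        show "Re (char (D P) s) = Re (complex_of_real (\<integral>x. cos (s * x) \<partial>D P) + \<i> * complex_of_real (\<integral>x. sin (s * x) \<partial>D P))"
          using integral_Re[OF i] by (simp add: char_def Re_exp)
        show "Im (char (D P) s) = Im (complex_of_real (\<integral>x. cos (s * x) \<partial>D P) + \<i> * complex_of_real (\<integral>x. sin (s * x) \<partial>D P))"
          using integral_Im[OF i] by (simp add: char_def Im_exp)
      qed
      moreover have "cos (y - pi/2) = sin y" for y :: real
        by (simp add: cos_diff)
      ultimately show ?thesis using 1 2 by simp
    qed
    have "D M = D N"
    proof (rule Levy_uniqueness)
      show "real_distribution (D M)" "real_distribution (D N)" 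
        using D[OF M refl c_def] D[OF N sets[symmetric] cN] by auto
      show "char (D M) = char (D N)" 
        by (intro ext) (simp only: D[OF M refl c_def, THEN conjunct2, THEN conjunct2, rule_format] 
            D[OF N sets[symmetric] cN, THEN conjunct2, THEN conjunct2, rule_format] eq)
    qed
    then have "(\<integral>x. w x * g (X x) \<partial>M) / c = (\<integral>x. w x * g (X x) \<partial>N) / c"
      using D[OF M refl c_def] D[OF N sets[symmetric] cN] by (metis assms(6))
    then show ?thesis using c by simp
  qed
qed

text \<open>The coordinates are treated one at a time: after some of the factors \<open>exp (i t\<^sub>b x\<^sub>b)\<close> have been
  replaced by arbitrary functions of \<open>x\<^sub>b\<close>, the next coordinate is handled by the one-dimensional
  theorem, applied to a measure weighted by the remaining factors.\<close>

theorem char_unique_euclidean: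
  fixes M N :: "'b::euclidean_space measure"
  assumes M: "prob_space M" and N: "prob_space N" 
    and sM: "sets M = sets borel" and sN: "sets N = sets borel"
    and char: "\<And>t. (\<integral>x. iexp (t \<bullet> x) \<partial>M) = (\<integral>x. iexp (t \<bullet> x) \<partial>N)"
  shows "M = N"
proof -
  interpret M: prob_space M by fact
  interpret N: prob_space N by fact
  note sM[measurable_cong] sN[measurable_cong]
  \<comment> \<open>Cosines with a free phase are real, so they can be multiplied by real weights,
    and a product of two of them is again a sum of such cosines.\<close>
  have cos0: "(\<integral>x. cos (t \<bullet> x + \<theta>) \<partial>M) = (\<integral>x. cos (t \<bullet> x + \<theta>) \<partial>N)" for t \<theta>
  proof -
    have *: "(\<integral>x. cos (t \<bullet> x + \<theta>) \<partial>P) = Re (iexp \<theta> * (\<integral>x. iexp (t \<bullet> x) \<partial>P))" 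
      if P: "prob_space P" and sP: "sets P = sets borel" for P :: "'b measure"
    proof -
      interpret P: prob_space P by fact
      note sP[measurable_cong]
      have i: "integrable P (\<lambda>x. iexp (t \<bullet> x))" by (rule P.integrable_iexp) auto
      have "(\<integral>x. cos (t \<bullet> x + \<theta>) \<partial>P) = (\<integral>x. Re (iexp \<theta> * iexp (t \<bullet> x)) \<partial>P)"
        by (intro Bochner_Integration.integral_cong) 
           (auto simp: exp_add[symmetric] distrib_left[symmetric] Re_exp cos_add simp del: of_real_add)
      also have "\<dots> = Re (\<integral>x. iexp \<theta> * iexp (t \<bullet> x) \<partial>P)"
        using i by (intro integral_Re integrable_mult_right) 
      finally show ?thesis by simp
    qed
    show ?thesis using *[OF M sM] *[OF N sN] char[of t] by simp
  qed
  \<comment> \<open>Frequency and phase stay arbitrary in the induction, because treating coordinate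
    \<open>b\<close> shifts the frequency along \<open>b\<close>. Factors with values in [0,1] are
    enough to reach indicators of intervals.\<close>
  have coord: "(\<integral>x. (\<Prod>b\<in>J. g b (x \<bullet> b)) * cos (t \<bullet> x + \<theta>) \<partial>M) = (\<integral>x. (\<Prod>b\<in>J. g b (x \<bullet> b)) * cos (t \<bullet> x + \<theta>) \<partial>N)"
    if "finite J" and g: "\<And>b. g b \<in> borel_measurable borel" "\<And>b y. 0 \<le> g b y" "\<And>b y. g b y \<le> 1"
    for J and g :: "'b \<Rightarrow> real \<Rightarrow> real" and t \<theta>
    using \<open>finite J\<close>
  proof (induction J arbitrary: t \<theta>)
    case empty
    then show ?case by (simp add: cos0)
  next
    case (insert b J)
    note [measurable] = g(1)
    define p where "p x = (\<Prod>b\<in>J. g b (x \<bullet> b))" for x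
    have p[measurable]: "p \<in> borel_measurable borel" unfolding p_def by measurable
    have p01: "0 \<le> p x" "p x \<le> 1" for x 
      unfolding p_def using g by (auto intro!: prod_nonneg prod_le_1)
    have pc: "\<bar>p x * cos y\<bar> \<le> 1" for x y
      using p01[of x] abs_cos_le_one[of y] by (simp add: abs_mult mult_le_one)
    have int: "integrable P (\<lambda>x. p x * cos (t \<bullet> x + \<theta>))" 
      if "prob_space P" "sets P = sets borel" for P and t :: 'b and \<theta>
    proof -
      interpret P: prob_space P by fact
      note that(2)[measurable_cong]
      show ?thesis by (rule P.integrable_const_bound[of _ 1]) (auto simp: pc)
    qed
    have IH: "(\<integral>x. p x * cos (t \<bullet> x + \<theta>) \<partial>M) = (\<integral>x. p x * cos (t \<bullet> x + \<theta>) \<partial>N)" for t \<theta>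
      using insert.IH by (simp add: p_def)
    \<comment> \<open>Product-to-sum formula: every term is a cosine weighted with \<open>p\<close>,
      at frequency \<open>s b\<close>, \<open>t + s b\<close> or \<open>t - s b\<close>, so the
      induction hypothesis applies to each.\<close>
    have prod: "(\<integral>x. p x * (1 + cos (t \<bullet> x + \<theta>)) * cos (s * (x \<bullet> b) + \<eta>) \<partial>P) = 
         (\<integral>x. p x * cos ((s *\<^sub>R b) \<bullet> x + \<eta>) \<partial>P)
         + (\<integral>x. p x * cos ((t + s *\<^sub>R b) \<bullet> x + (\<theta> + \<eta>)) \<partial>P) / 2
         + (\<integral>x. p x * cos ((t - s *\<^sub>R b) \<bullet> x + (\<theta> - \<eta>)) \<partial>P) / 2"
      if "prob_space P" "sets P = sets borel" for P s \<eta>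
    proof -
      have "(\<integral>x. p x * (1 + cos (t \<bullet> x + \<theta>)) * cos (s * (x \<bullet> b) + \<eta>) \<partial>P) = 
         (\<integral>x. p x * cos ((s *\<^sub>R b) \<bullet> x + \<eta>) + p x * cos ((t + s *\<^sub>R b) \<bullet> x + (\<theta> + \<eta>)) / 2
           + p x * cos ((t - s *\<^sub>R b) \<bullet> x + (\<theta> - \<eta>)) / 2 \<partial>P)"
      proof (intro Bochner_Integration.integral_cong refl)
        fix x
        have "cos (t \<bullet> x + \<theta>) * cos (s * (x \<bullet> b) + \<eta>) 
            = (cos ((t - s *\<^sub>R b) \<bullet> x + (\<theta> - \<eta>)) + cos ((t + s *\<^sub>R b) \<bullet> x + (\<theta> + \<eta>))) / 2"
          by (subst cos_times_cos) (simp add: inner_left_distrib inner_diff_left inner_commute algebra_simps)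
        then show "p x * (1 + cos (t \<bullet> x + \<theta>)) * cos (s * (x \<bullet> b) + \<eta>) =
         p x * cos ((s *\<^sub>R b) \<bullet> x + \<eta>) + p x * cos ((t + s *\<^sub>R b) \<bullet> x + (\<theta> + \<eta>)) / 2 +
         p x * cos ((t - s *\<^sub>R b) \<bullet> x + (\<theta> - \<eta>)) / 2"
          by (simp add: distrib_left distrib_right mult.assoc inner_commute add_divide_distrib)
      qed
      then show ?thesis 
        by (simp add: int[OF that] del: inner_scaleR_left)
    qed
    \<comment> \<open>The one-dimensional uniqueness theorem needs nonnegative weights: hence \<open>1 + cos\<close> instead of
      \<open>cos\<close>, the difference being the case of the weight \<open>p\<close>.\<close>
    have A: "(\<integral>x. p x * (1 + cos (t \<bullet> x + \<theta>)) * g b (x \<bullet> b) \<partial>M) = (\<integral>x. p x * (1 + cos (t \<bullet> x + \<theta>)) * g b (x \<bullet> b) \<partial>N)"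
    proof (rule weighted_distr_unique[where B=2 and w="\<lambda>x. p x * (1 + cos (t \<bullet> x + \<theta>))" and X="\<lambda>x. x \<bullet> b" and g="g b"])
      show "(\<integral>x. p x * (1 + cos (t \<bullet> x + \<theta>)) * cos (s * (x \<bullet> b) + \<eta>) \<partial>M)
          = (\<integral>x. p x * (1 + cos (t \<bullet> x + \<theta>)) * cos (s * (x \<bullet> b) + \<eta>) \<partial>N)" for s \<eta>
        by (simp only: prod[OF M sM] prod[OF N sN] IH)
      show "0 \<le> p x * (1 + cos (t \<bullet> x + \<theta>))" for x 
        using p01[of x] cos_ge_minus_one[of "t \<bullet> x + \<theta>"] by (intro mult_nonneg_nonneg) linarith+
      show "p x * (1 + cos (t \<bullet> x + \<theta>)) \<le> 2" for x 
        using p01[of x] cos_ge_minus_one[of "t \<bullet> x + \<theta>"] cos_le_one[of "t \<bullet> x + \<theta>"] 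
          mult_mono[of "p x" 1 "1 + cos (t \<bullet> x + \<theta>)" 2] by linarith
    qed (auto simp: sM sN M.finite_measure_axioms N.finite_measure_axioms)
    have B: "(\<integral>x. p x * g b (x \<bullet> b) \<partial>M) = (\<integral>x. p x * g b (x \<bullet> b) \<partial>N)"
    proof (rule weighted_distr_unique[where B=1 and w=p and X="\<lambda>x. x \<bullet> b" and g="g b"])
      show "(\<integral>x. p x * cos (s * (x \<bullet> b) + \<eta>) \<partial>M) = (\<integral>x. p x * cos (s * (x \<bullet> b) + \<eta>) \<partial>N)" for s \<eta>
        using IH[of "s *\<^sub>R b" \<eta>] by (simp add: inner_commute)
    qed (auto simp: sM sN M.finite_measure_axioms N.finite_measure_axioms p01)
    have split: "(\<integral>x. g b (x \<bullet> b) * p x * cos (t \<bullet> x + \<theta>) \<partial>P) = 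
       (\<integral>x. p x * (1 + cos (t \<bullet> x + \<theta>)) * g b (x \<bullet> b) \<partial>P) - (\<integral>x. p x * g b (x \<bullet> b) \<partial>P)"
      if P: "prob_space P" and sP: "sets P = sets borel" for P
    proof -
      interpret P: prob_space P by fact
      note sP[measurable_cong]
      have 1: "\<bar>g b y * p x * cos z\<bar> \<le> 1" "\<bar>p x * g b y\<bar> \<le> 1" for x y z
        using pc[of x z] g(2,3)[of b y] p01[of x] by (auto simp: abs_mult mult.assoc intro!: mult_le_one)
      have "integrable P (\<lambda>x. g b (x \<bullet> b) * p x * cos (t \<bullet> x + \<theta>))"
           "integrable P (\<lambda>x. p x * g b (x \<bullet> b))"
        using 1 by (auto intro!: P.integrable_const_bound[of _ 1])
      moreover have "p x * (1 + cos (t \<bullet> x + \<theta>)) * g b (x \<bullet> b) = g b (x \<bullet> b) * p x * cos (t \<bullet> x + \<theta>) + p x * g b (x \<bullet> b)" for x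
        by (simp add: algebra_simps)
      ultimately show ?thesis by simp
    qed
    have "(\<integral>x. g b (x \<bullet> b) * p x * cos (t \<bullet> x + \<theta>) \<partial>M) = (\<integral>x. g b (x \<bullet> b) * p x * cos (t \<bullet> x + \<theta>) \<partial>N)"
      unfolding split[OF M sM] split[OF N sN] A B ..
    then show ?case using insert.hyps by (simp add: p_def)
  qed
  have box: "measure M (box a b) = measure N (box a b)" for a b
  proof -
    \<comment> \<open>At frequency and phase zero the cosine is 1, and the interval indicators
      multiply to the indicator of an open box.\<close>
    have *: "measure P (box a b) = (\<integral>x. (\<Prod>i\<in>Basis. indicator {a \<bullet> i <..< b \<bullet> i} (x \<bullet> i)) * cos (0 \<bullet> x + 0) \<partial>P)"
      if "prob_space P" and sP: "sets P = sets borel" for P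
    proof -
      have "(\<Prod>i\<in>Basis. indicator {a \<bullet> i <..< b \<bullet> i} (x \<bullet> i)) * cos (0 \<bullet> x + 0) = (indicator (box a b) x :: real)" for x
        by (auto simp: indicator_def box_def)
      then have "(\<integral>x. (\<Prod>i\<in>Basis. indicator {a \<bullet> i <..< b \<bullet> i} (x \<bullet> i)) * cos (0 \<bullet> x + 0) \<partial>P)
          = measure P (box a b \<inter> space P)"
        by simp
      then show ?thesis using sP sets_eq_imp_space_eq[OF sP] by simp
    qed
    show ?thesis unfolding *[OF M sM] *[OF N sN] by (rule coord) (auto simp: indicator_def)
  qed
  show ?thesis
  proof (rule measure_eqI_generator_eq[where E="range (\<lambda>(a, b). box a b)" and \<Omega>=UNIV 
        and A="\<lambda>n. box (- (real n *\<^sub>R One)) (real n *\<^sub>R One)"])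
    show "Int_stable (range (\<lambda>(a, b). box a b :: 'b set))"
    proof (rule Int_stableI_image)
      fix u v :: "'b \<times> 'b"
      show "\<exists>w\<in>UNIV. (case u of (a, b) \<Rightarrow> box a b) \<inter> (case v of (a, b) \<Rightarrow> box a b) = (case w of (a, b) \<Rightarrow> box a b)"
        unfolding split_beta box_Int_box
        by (rule bexI[where x="(\<Sum>i\<in>Basis. max (fst u \<bullet> i) (fst v \<bullet> i) *\<^sub>R i, 
              \<Sum>i\<in>Basis. min (snd u \<bullet> i) (snd v \<bullet> i) *\<^sub>R i)"]) simp_all
    qed
    show "(\<Union>n. box (- (real n *\<^sub>R One)) (real n *\<^sub>R One)) = (UNIV :: 'b set)"
      by (rule UN_box_eq_UNIV)
  qed (auto simp: sM sN borel_eq_box M.emeasure_eq_measure N.emeasure_eq_measure box)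
qed

section \<open>Gaussian integration by parts\<close>

lemma (in prob_space) char_normal:
  assumes D: "distributed M lborel Y (normal_density 0 \<sigma>)" and \<sigma>: "0 < \<sigma>"
  shows "(\<integral>\<omega>. iexp (t * Y \<omega>) \<partial>M) = complex_of_real (exp (- (t\<^sup>2 * \<sigma>\<^sup>2) / 2))"
proof -
  have [measurable]: "Y \<in> borel_measurable M" using distributed_measurable[OF D] by simp
  have "distributed M lborel (\<lambda>\<omega>. Y \<omega> / \<sigma>) std_normal_density"
    using D normal_standard_normal_convert[OF \<sigma>, of Y 0] by simp
  then have "distr M borel (\<lambda>\<omega>. Y \<omega> / \<sigma>) = std_normal_distribution"
    by (simp add: distributed_def cong: distr_cong)
  then have "char (distr M borel (\<lambda>\<omega>. Y \<omega> / \<sigma>)) (t * \<sigma>) = complex_of_real (exp (- ((t * \<sigma>)\<^sup>2) / 2))"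
    by (simp add: char_std_normal_distribution)
  moreover have "char (distr M borel (\<lambda>\<omega>. Y \<omega> / \<sigma>)) (t * \<sigma>) = (\<integral>\<omega>. iexp (t * Y \<omega>) \<partial>M)"
    unfolding char_def using \<sigma> by (subst integral_distr) auto
  ultimately show ?thesis by (simp add: power_mult_distrib)
qed

lemma (in prob_space) normal_if_char:
  assumes [measurable]: "Y \<in> borel_measurable M" and \<sigma>: "0 < \<sigma>"
    and char: "\<And>t. (\<integral>\<omega>. iexp (t * Y \<omega>) \<partial>M) = complex_of_real (exp (- (t\<^sup>2 * \<sigma>\<^sup>2) / 2))"
  shows "distributed M lborel Y (normal_density 0 \<sigma>)"
proof -
  let ?N = "density lborel (normal_density 0 \<sigma>)"
  interpret N: prob_space ?N using \<sigma> by (rule prob_space_normal_density)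
  have "distr M borel Y = ?N"
  proof (rule Levy_uniqueness)
    show "real_distribution (distr M borel Y)" by (rule real_distribution_distr) simp
    show "real_distribution ?N"
      by (simp add: real_distribution_def real_distribution_axioms_def N.prob_space_axioms)
    have "distributed ?N lborel (\<lambda>x. x) (normal_density 0 \<sigma>)"
      by (auto simp: distributed_def distr_id2)
    note N = N.char_normal[OF this \<sigma>]
    have "char (distr M borel Y) t = (\<integral>\<omega>. iexp (t * Y \<omega>) \<partial>M)" for t
      by (simp add: char_def integral_distr)
    moreover have "char ?N t = complex_of_real (exp (- (t\<^sup>2 * \<sigma>\<^sup>2) / 2))" for t
      unfolding char_def by (rule N)
    ultimately show "char (distr M borel Y) = char ?N"
      by (simp only: fun_eq_iff char) simp
  qed
  then show ?thesis by (simp add: distributed_def cong: distr_cong)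
qed

lemma normal_density_has_real_derivative:
  assumes "0 < \<sigma>"
  shows "(normal_density 0 \<sigma> has_real_derivative (- z / \<sigma>\<^sup>2 * normal_density 0 \<sigma> z)) (at z)"
  unfolding normal_density_def using assms
  by (auto intro!: derivative_eq_intros simp: field_simps)

lemma normal_density_tendsto_0:
  assumes "0 < \<sigma>"
  shows "(normal_density 0 \<sigma> \<longlongrightarrow> 0) at_top" "(normal_density 0 \<sigma> \<longlongrightarrow> 0) at_bot"
proof -
  have *: "(normal_density 0 \<sigma> \<longlongrightarrow> 0) F" if F: "filterlim (\<lambda>z::real. z\<^sup>2) at_top F" for F
  proof -
    have "filterlim (\<lambda>z. inverse (2 * \<sigma>\<^sup>2) * z\<^sup>2) at_top F"
      using assms F by (intro filterlim_tendsto_pos_mult_at_top[OF tendsto_const]) auto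
    then have "filterlim (\<lambda>z. - (inverse (2 * \<sigma>\<^sup>2) * z\<^sup>2)) at_bot F"
      by (simp add: filterlim_uminus_at_top)
    then have "((\<lambda>z. exp (- (inverse (2 * \<sigma>\<^sup>2) * z\<^sup>2))) \<longlongrightarrow> 0) F"
      by (rule filterlim_compose[OF exp_at_bot])
    then have "((\<lambda>z. 1 / sqrt (2 * pi * \<sigma>\<^sup>2) * exp (- (inverse (2 * \<sigma>\<^sup>2) * z\<^sup>2))) \<longlongrightarrow> 
        1 / sqrt (2 * pi * \<sigma>\<^sup>2) * 0) F"
      by (intro tendsto_mult tendsto_const)
    then show ?thesis by (simp add: normal_density_def[abs_def] field_simps)
  qed
  show "(normal_density 0 \<sigma> \<longlongrightarrow> 0) at_top" 
    by (intro * filterlim_pow_at_top filterlim_ident) auto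
  show "(normal_density 0 \<sigma> \<longlongrightarrow> 0) at_bot"
    by (intro * filterlim_pow_at_bot_even filterlim_ident) auto
qed

text \<open>The density n satisfies n' = -z n / \<sigma>^2, so -\<sigma>^2 n g is an antiderivative
  of the difference of the two integrands. It vanishes at both ends because g is bounded, hence the
  difference integrates to 0.\<close>

lemma stein_normal:
  fixes g g' :: "real \<Rightarrow> real"
  assumes \<sigma>: "0 < \<sigma>" and g: "\<And>z. (g has_real_derivative g' z) (at z)" and g': "\<And>z. isCont g' z"
    and B: "\<And>z. \<bar>g z\<bar> \<le> B" "\<And>z. \<bar>g' z\<bar> \<le> B"
  shows "(\<integral>z. g z * z \<partial>density lborel (normal_density 0 \<sigma>)) 
    = \<sigma>\<^sup>2 * (\<integral>z. g' z \<partial>density lborel (normal_density 0 \<sigma>))"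
proof -
  let ?n = "normal_density 0 \<sigma>"
  have gc: "isCont g z" for z using g by (rule DERIV_isCont)
  have [measurable]: "g \<in> borel_measurable borel" "g' \<in> borel_measurable borel"
    using gc g' by (auto intro!: borel_measurable_continuous_onI continuous_at_imp_continuous_on)
  have nc: "isCont ?n z" for z 
    using normal_density_has_real_derivative[OF \<sigma>] by (rule DERIV_isCont)
  have i1: "integrable lborel (\<lambda>z. ?n z * (g z * z))"
  proof (rule Bochner_Integration.integrable_bound)
    show "integrable lborel (\<lambda>z. B * (?n z * \<bar>z\<bar>))" 
      using integrable_normal_moment_abs[OF \<sigma>, of 0 1] by simp
    show "AE z in lborel. norm (?n z * (g z * z)) \<le> norm (B * (?n z * \<bar>z\<bar>))"
    proof (rule AE_I2)
      fix z
      have "0 \<le> B" using B(1)[of 0] by linarith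
      then show "norm (?n z * (g z * z)) \<le> norm (B * (?n z * \<bar>z\<bar>))"
        using mult_right_mono[OF B(1)[of z], of "?n z * \<bar>z\<bar>"] by (simp add: abs_mult mult.left_commute)
    qed
  qed measurable
  have i2: "integrable lborel (\<lambda>z. ?n z * g' z)"
  proof (rule Bochner_Integration.integrable_bound)
    show "integrable lborel (\<lambda>z. B * ?n z)" using \<sigma> by simp
    show "AE z in lborel. norm (?n z * g' z) \<le> norm (B * ?n z)"
    proof (rule AE_I2)
      fix z
      have "0 \<le> B" using B(1)[of 0] by linarith
      then show "norm (?n z * g' z) \<le> norm (B * ?n z)"
        using mult_right_mono[OF B(2)[of z], of "?n z"] by (simp add: abs_mult mult.commute)
    qed
  qed measurable
  define F where "F z = - \<sigma>\<^sup>2 * ?n z * g z" for z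
  define f where "f z = ?n z * (g z * z) - \<sigma>\<^sup>2 * (?n z * g' z)" for z
  have F: "(F has_real_derivative f z) (at z)" for z
    unfolding F_def f_def using \<sigma>
    by (auto intro!: derivative_eq_intros g normal_density_has_real_derivative simp: field_simps)
  have i: "integrable lborel f" unfolding f_def using i1 i2 by simp
  have lim: "(F \<longlongrightarrow> 0) G" if G: "(?n \<longlongrightarrow> 0) G" for G
  proof (rule Lim_null_comparison)
    show "\<forall>\<^sub>F z in G. norm (F z) \<le> \<sigma>\<^sup>2 * B * ?n z"
    proof (intro always_eventually allI)
      fix z show "norm (F z) \<le> \<sigma>\<^sup>2 * B * ?n z"
        using mult_right_mono[OF B(1)[of z], of "\<sigma>\<^sup>2 * ?n z"] by (simp add: F_def abs_mult mult_ac)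
    qed
    show "((\<lambda>z. \<sigma>\<^sup>2 * B * ?n z) \<longlongrightarrow> 0) G" using tendsto_mult_right_zero[OF G] .
  qed
  have "(LBINT z=-\<infinity>..\<infinity>. f z) = 0 - 0"
  proof (rule interval_integral_FTC_integrable)
    show "(F has_vector_derivative f z) (at z)" for z 
      using F by (simp add: has_real_derivative_iff_has_vector_derivative)
    show "isCont f z" for z unfolding f_def by (intro continuous_intros nc gc g')
    show "set_integrable lborel (einterval (- \<infinity>) \<infinity>) f" using i by (simp add: set_integrable_def)
    show "((F \<circ> real_of_ereal) \<longlongrightarrow> 0) (at_right (- \<infinity>))"
      using lim[OF normal_density_tendsto_0(2)[OF \<sigma>]] by (simp add: ereal_tendsto_simps)
    show "((F \<circ> real_of_ereal) \<longlongrightarrow> 0) (at_left \<infinity>)"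
      using lim[OF normal_density_tendsto_0(1)[OF \<sigma>]] by (simp add: ereal_tendsto_simps)
  qed auto
  then have "(\<integral>z. f z \<partial>lborel) = 0" by (simp add: interval_lebesgue_integral_def set_lebesgue_integral_def)
  then show ?thesis unfolding f_def using i1 i2 by (simp add: integral_density)
qed

text \<open>Factorisation of the joint characteristic function means independence. Independence is
  expressed as equality of the product law with the joint law, the form to which Fubini
  applies.\<close>

lemma (in prob_space) distr_pair_eq_if_char:
  fixes V :: "'a \<Rightarrow> 'b::euclidean_space" and Z :: "'a \<Rightarrow> 'c::euclidean_space"
  assumes [measurable]: "V \<in> borel_measurable M" "Z \<in> borel_measurable M"
    and char: "\<And>t s. (\<integral>\<omega>. iexp (t \<bullet> V \<omega> + s \<bullet> Z \<omega>) \<partial>M)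
      = (\<integral>\<omega>. iexp (t \<bullet> V \<omega>) \<partial>M) * (\<integral>\<omega>. iexp (s \<bullet> Z \<omega>) \<partial>M)"
  shows "distr M borel V \<Otimes>\<^sub>M distr M borel Z = distr M (borel \<Otimes>\<^sub>M borel) (\<lambda>\<omega>. (V \<omega>, Z \<omega>))"
proof -
  interpret V: prob_space "distr M borel V" by (rule prob_space_distr) simp
  interpret Z: prob_space "distr M borel Z" by (rule prob_space_distr) simp
  interpret VZ: pair_prob_space "distr M borel V" "distr M borel Z" ..
  show ?thesis
  proof (rule char_unique_euclidean)
    show "prob_space (distr M borel V \<Otimes>\<^sub>M distr M borel Z)" by (rule VZ.prob_space_axioms)
    show "prob_space (distr M (borel \<Otimes>\<^sub>M borel) (\<lambda>\<omega>. (V \<omega>, Z \<omega>)))" 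
      by (rule prob_space_distr) simp
    show "sets (distr M borel V \<Otimes>\<^sub>M distr M borel Z) = sets borel"
      by (simp add: borel_prod[symmetric] cong: sets_pair_measure_cong)
    show "sets (distr M (borel \<Otimes>\<^sub>M borel) (\<lambda>\<omega>. (V \<omega>, Z \<omega>))) = sets borel"
      by (simp add: borel_prod)
    fix u :: "'b \<times> 'c"
    obtain t s where u: "u = (t, s)" by (cases u)
    have i: "integrable (distr M borel V \<Otimes>\<^sub>M distr M borel Z) (\<lambda>x. iexp (u \<bullet> x))"
      by (rule VZ.integrable_iexp) (simp_all add: u inner_prod_def)
    have "(\<integral>x. iexp (u \<bullet> x) \<partial>(distr M borel V \<Otimes>\<^sub>M distr M borel Z))
        = (\<integral>v. (\<integral>z. iexp (u \<bullet> (v, z)) \<partial>distr M borel Z) \<partial>distr M borel V)"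
      by (rule VZ.integral_fst'[symmetric, OF i])
    also have "\<dots> = (\<integral>v. (\<integral>z. iexp (t \<bullet> v) * iexp (s \<bullet> z) \<partial>distr M borel Z) \<partial>distr M borel V)"
      by (simp add: u exp_add[symmetric] distrib_left)
    also have "\<dots> = (\<integral>\<omega>. iexp (t \<bullet> V \<omega>) \<partial>M) * (\<integral>\<omega>. iexp (s \<bullet> Z \<omega>) \<partial>M)"
      by (simp add: integral_distr)
    also have "\<dots> = (\<integral>x. iexp (u \<bullet> x) \<partial>distr M (borel \<Otimes>\<^sub>M borel) (\<lambda>\<omega>. (V \<omega>, Z \<omega>)))"
      unfolding char[symmetric] by (subst integral_distr) (auto simp: u borel_prod)
    finally show "(\<integral>x. iexp (u \<bullet> x) \<partial>(distr M borel V \<Otimes>\<^sub>M distr M borel Z))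
        = (\<integral>x. iexp (u \<bullet> x) \<partial>distr M (borel \<Otimes>\<^sub>M borel) (\<lambda>\<omega>. (V \<omega>, Z \<omega>)))" .
  qed
qed

text \<open>The assumption on the characteristic function says that \<open>(Y, Z)\<close> is centred Gaussian with
  \<open>k = E(Y Z)\<close>; \<open>Q\<close> is the covariance form of \<open>Y\<close>, of which only \<open>Q 0 = 0\<close> matters.
  The vector \<open>V = Y - (Z / \<sigma>\<^sup>2) k\<close> is independent of \<open>Z\<close>, which reduces the claim to Stein's identity
  for \<open>Z\<close> with \<open>V\<close> frozen.\<close>

theorem (in prob_space) gaussian_integration_by_parts:
  fixes Y :: "'a \<Rightarrow> 'b::euclidean_space" and f :: "'b \<Rightarrow> real" and k :: 'b
  assumes Y[measurable]: "Y \<in> borel_measurable M" and Z[measurable]: "Z \<in> borel_measurable M" 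
    and \<sigma>: "0 < \<sigma>"
    and char: "\<And>t s. (\<integral>\<omega>. iexp (t \<bullet> Y \<omega> + s * Z \<omega>) \<partial>M) 
      = complex_of_real (exp (- (Q t + 2 * s * (t \<bullet> k) + s\<^sup>2 * \<sigma>\<^sup>2) / 2))"
    and Q0: "Q 0 = 0"
    and f: "\<And>x. (f has_derivative f' x) (at x)" and f': "\<And>x. isCont (\<lambda>x. f' x k) x"
    and B: "\<And>x. \<bar>f x\<bar> \<le> B" "\<And>x. \<bar>f' x k\<bar> \<le> B"
  shows "(\<integral>\<omega>. f (Y \<omega>) * Z \<omega> \<partial>M) = (\<integral>\<omega>. f' (Y \<omega>) k \<partial>M)"
proof -
  have fc: "isCont f x" for x using f has_derivative_continuous by blast
  have [measurable]: "f \<in> borel_measurable borel" "(\<lambda>x. f' x k) \<in> borel_measurable borel"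
    using fc f' by (auto intro!: borel_measurable_continuous_onI continuous_at_imp_continuous_on)
  have Zn: "distributed M lborel Z (normal_density 0 \<sigma>)"
    using char[of 0] by (intro normal_if_char \<sigma>) (auto simp: Q0)
  then have dZ: "distr M borel Z = density lborel (normal_density 0 \<sigma>)"
    by (simp add: distributed_def cong: distr_cong)
  define V where "V \<omega> = Y \<omega> - (Z \<omega> / \<sigma>\<^sup>2) *\<^sub>R k" for \<omega>
  have V[measurable]: "V \<in> borel_measurable M" unfolding V_def by measurable
  have charVZ: "(\<integral>\<omega>. iexp (t \<bullet> V \<omega> + s * Z \<omega>) \<partial>M) 
      = complex_of_real (exp (- (Q t - (t \<bullet> k)\<^sup>2 / \<sigma>\<^sup>2 + s\<^sup>2 * \<sigma>\<^sup>2) / 2))" for t s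
  proof -
    \<comment> \<open>Passing from \<open>Y\<close> to \<open>V\<close> shifts \<open>s\<close> by
      -(t . k) / \<sigma>^2; this completes the square in the exponent and removes the term that
      mixes \<open>t\<close> and \<open>s\<close>.\<close>
    have "(\<integral>\<omega>. iexp (t \<bullet> V \<omega> + s * Z \<omega>) \<partial>M) = (\<integral>\<omega>. iexp (t \<bullet> Y \<omega> + (s - (t \<bullet> k) / \<sigma>\<^sup>2) * Z \<omega>) \<partial>M)"
      by (intro Bochner_Integration.integral_cong refl arg_cong[where f=iexp]) 
        (simp add: V_def inner_diff_right algebra_simps)
    moreover have "Q t + 2 * (s - (t \<bullet> k) / \<sigma>\<^sup>2) * (t \<bullet> k) + (s - (t \<bullet> k) / \<sigma>\<^sup>2)\<^sup>2 * \<sigma>\<^sup>2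
      = Q t - (t \<bullet> k)\<^sup>2 / \<sigma>\<^sup>2 + s\<^sup>2 * \<sigma>\<^sup>2"
      using \<sigma> by (simp add: field_simps power2_eq_square)
    ultimately show ?thesis unfolding char by simp
  qed
  have dVZ: "distr M borel V \<Otimes>\<^sub>M distr M borel Z = distr M (borel \<Otimes>\<^sub>M borel) (\<lambda>\<omega>. (V \<omega>, Z \<omega>))"
  proof (rule distr_pair_eq_if_char)
    fix t :: 'b and s :: real
    show "(\<integral>\<omega>. iexp (t \<bullet> V \<omega> + s \<bullet> Z \<omega>) \<partial>M) = (\<integral>\<omega>. iexp (t \<bullet> V \<omega>) \<partial>M) * (\<integral>\<omega>. iexp (s \<bullet> Z \<omega>) \<partial>M)"
      using charVZ[of t s] charVZ[of t 0] charVZ[of 0 s]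
      by (simp add: Q0 of_real_mult[symmetric] exp_add[symmetric] add_divide_distrib diff_divide_distrib 
          del: of_real_mult of_real_add)
  qed simp_all
  interpret V: prob_space "distr M borel V" by (rule prob_space_distr) simp
  interpret Z: prob_space "distr M borel Z" by (rule prob_space_distr) simp
  interpret VZ: pair_prob_space "distr M borel V" "distr M borel Z" ..
  have YV: "Y \<omega> = V \<omega> + (Z \<omega> / \<sigma>\<^sup>2) *\<^sub>R k" for \<omega> by (simp add: V_def)
  have iZ: "integrable M Z"
    using integrable_normal_moment_nz_1[OF \<sigma>, of 0] distributed_integrable[OF Zn, of "\<lambda>x. x"] by simp
  have ifZ: "integrable M (\<lambda>\<omega>. f (Y \<omega>) * Z \<omega>)"
  proof (rule Bochner_Integration.integrable_bound)
    show "integrable M (\<lambda>\<omega>. B * Z \<omega>)" using iZ by simp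
    show "AE \<omega> in M. norm (f (Y \<omega>) * Z \<omega>) \<le> norm (B * Z \<omega>)"
      by (rule AE_I2) (auto simp: abs_mult intro!: mult_right_mono order_trans[OF B(1)])
  qed simp
  have if': "integrable M (\<lambda>\<omega>. f' (Y \<omega>) k)"
    by (rule integrable_const_bound[of _ B]) (auto simp: B measurable_compose[OF Y])
  \<comment> \<open>Fubini for the independent pair: \<open>V\<close> is frozen while
    \<open>Z\<close> is integrated out.\<close>
  have fub: "(\<integral>\<omega>. G (V \<omega>) (Z \<omega>) \<partial>M) = (\<integral>v. (\<integral>z. G v z \<partial>distr M borel Z) \<partial>distr M borel V)"
    if i: "integrable M (\<lambda>\<omega>. G (V \<omega>) (Z \<omega>))" 
      and [measurable]: "(\<lambda>(v, z). G v z) \<in> borel_measurable (borel \<Otimes>\<^sub>M borel)"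
    for G :: "'b \<Rightarrow> real \<Rightarrow> real"
  proof -
    have "integrable (distr M borel V \<Otimes>\<^sub>M distr M borel Z) (\<lambda>(v, z). G v z)"
      unfolding dVZ using i by (subst integrable_distr_eq) auto
    from VZ.integral_fst'[OF this] show ?thesis
      unfolding dVZ by (subst (asm) (2) integral_distr) auto
  qed
  have stein: "(\<integral>z. f (v + (z / \<sigma>\<^sup>2) *\<^sub>R k) * z \<partial>distr M borel Z) 
      = (\<integral>z. f' (v + (z / \<sigma>\<^sup>2) *\<^sub>R k) k \<partial>distr M borel Z)" for v
  proof -
    \<comment> \<open>The inner derivative contributes 1 / \<sigma>^2, which cancels the factor
      \<sigma>^2 of Stein's identity. One bound has to serve both the function, bounded by
      \<open>B\<close>, and its derivative, bounded by B / \<sigma>^2; hence the maximum.\<close>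
    have "(\<integral>z. f (v + (z / \<sigma>\<^sup>2) *\<^sub>R k) * z \<partial>density lborel (normal_density 0 \<sigma>))
        = \<sigma>\<^sup>2 * (\<integral>z. f' (v + (z / \<sigma>\<^sup>2) *\<^sub>R k) k / \<sigma>\<^sup>2 \<partial>density lborel (normal_density 0 \<sigma>))"
    proof (rule stein_normal[where B="max B (B / \<sigma>\<^sup>2)"])
      fix z
      have "((\<lambda>z. f (v + (z / \<sigma>\<^sup>2) *\<^sub>R k)) has_derivative (\<lambda>h. f' (v + (z / \<sigma>\<^sup>2) *\<^sub>R k) ((h / \<sigma>\<^sup>2) *\<^sub>R k))) (at z)"
      proof (rule has_derivative_compose[OF _ f])
        have "((\<lambda>z. v + z *\<^sub>R w) has_derivative (\<lambda>h. h *\<^sub>R w)) (at z)" for w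
          by (auto intro!: derivative_eq_intros)
        from this[of "(1 / \<sigma>\<^sup>2) *\<^sub>R k"]
        show "((\<lambda>z. v + (z / \<sigma>\<^sup>2) *\<^sub>R k) has_derivative (\<lambda>h. (h / \<sigma>\<^sup>2) *\<^sub>R k)) (at z)" by simp
      qed
      moreover have "f' x ((h / \<sigma>\<^sup>2) *\<^sub>R k) = (f' x k / \<sigma>\<^sup>2) * h" for x h
        using has_derivative_linear[OF f, of x] by (simp add: linear_scale)
      ultimately show "((\<lambda>z. f (v + (z / \<sigma>\<^sup>2) *\<^sub>R k)) has_real_derivative f' (v + (z / \<sigma>\<^sup>2) *\<^sub>R k) k / \<sigma>\<^sup>2) (at z)"
        by (simp only: has_field_derivative_def)
      show "isCont (\<lambda>z. f' (v + (z / \<sigma>\<^sup>2) *\<^sub>R k) k / \<sigma>\<^sup>2) z"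
        using \<sigma> by (intro continuous_intros isCont_o2[OF _ f']) auto
      show "\<bar>f (v + (z / \<sigma>\<^sup>2) *\<^sub>R k)\<bar> \<le> max B (B / \<sigma>\<^sup>2)" using B(1) by (simp add: le_max_iff_disj)
      show "\<bar>f' (v + (z / \<sigma>\<^sup>2) *\<^sub>R k) k / \<sigma>\<^sup>2\<bar> \<le> max B (B / \<sigma>\<^sup>2)" 
        using B(2) by (auto simp: le_max_iff_disj abs_divide intro!: divide_right_mono)
    qed (rule \<sigma>)
    then show ?thesis using \<sigma> unfolding dZ by simp
  qed
  have "(\<integral>\<omega>. f (Y \<omega>) * Z \<omega> \<partial>M) = (\<integral>v. (\<integral>z. f (v + (z / \<sigma>\<^sup>2) *\<^sub>R k) * z \<partial>distr M borel Z) \<partial>distr M borel V)"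
    using ifZ unfolding YV by (intro fub) simp_all
  also have "\<dots> = (\<integral>v. (\<integral>z. f' (v + (z / \<sigma>\<^sup>2) *\<^sub>R k) k \<partial>distr M borel Z) \<partial>distr M borel V)"
    unfolding stein ..
  also have "\<dots> = (\<integral>\<omega>. f' (Y \<omega>) k \<partial>M)"
    using if' unfolding YV by (intro fub[symmetric]) simp_all
  finally show ?thesis .
qed

section \<open>Variations of finite signed measures\<close>

context
  fixes N :: "'b measure" and \<mu> :: "'b set \<Rightarrow> ereal"
  assumes signed: "signed_measure N \<mu>"
begin

lemma signed_measure_Un:
  assumes "A \<in> sets N" "B \<in> sets N" "A \<inter> B = {}"
  shows "\<mu> (A \<union> B) = \<mu> A + \<mu> B"
proof -
  have 0: "\<mu> {} = 0" using signed by (simp add: signed_measure_def)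

  have *: "\<mu> (binaryset A B n) = 0" if "n \<notin> {..<2}" for n
    using that by (auto simp: binaryset_def 0)
  have "range (binaryset A B) \<subseteq> sets N"
    using assms by (auto simp: binaryset_def)
  moreover have "disjoint_family (binaryset A B)"
    using assms by (auto simp: binaryset_def disjoint_family_on_def)
  ultimately have "(\<lambda>n. \<mu> (binaryset A B n)) sums \<mu> (\<Union>n. binaryset A B n)"
    using signed by (auto simp: signed_measure_def)
  moreover have "(\<lambda>n. \<mu> (binaryset A B n)) sums (\<Sum>n<2. \<mu> (binaryset A B n))"
    by (rule sums_finite) (auto simp: *)
  ultimately show ?thesis
    by (simp add: sums_unique2 UN_binaryset_eq) (simp add: binaryset_def numeral_2_eq_2 sums_unique2)
qed

text \<open>A signed measure omits one of the two infinite values, so the values on A and on its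
  complement cannot be opposite infinities; a finite sum then forces finite summands.\<close>

lemma signed_measure_finite:
  assumes fin: "\<bar>\<mu> (space N)\<bar> \<noteq> \<infinity>" and A: "A \<in> sets N"
  shows "\<bar>\<mu> A\<bar> \<noteq> \<infinity>"
proof -
  have "\<mu> (space N) = \<mu> A + \<mu> (space N - A)"
    using signed_measure_Un[of A "space N - A"] A sets.sets_into_space[OF A] by (simp add: Un_absorb1)
  moreover have "(\<mu> A \<noteq> \<infinity> \<and> \<mu> (space N - A) \<noteq> \<infinity>) \<or> (\<mu> A \<noteq> -\<infinity> \<and> \<mu> (space N - A) \<noteq> -\<infinity>)"
    using signed A by (auto simp: signed_measure_def)
  ultimately show ?thesis using fin
    by (cases "\<mu> A"; cases "\<mu> (space N - A)") auto
qed

end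

locale finite_signed_measure =
  fixes N :: "'b measure" and \<mu> :: "'b set \<Rightarrow> ereal"
  assumes signed: "signed_measure N \<mu>" and finite_space: "\<bar>\<mu> (space N)\<bar> \<noteq> \<infinity>"
begin

definition m :: "'b set \<Rightarrow> real" where "m A = real_of_ereal (\<mu> A)"

lemma mu_eq_m: "A \<in> sets N \<Longrightarrow> \<mu> A = ereal (m A)"
  using signed_measure_finite[OF signed finite_space] by (simp add: m_def ereal_real')

lemma m_empty: "m {} = 0"
  using signed by (simp add: m_def signed_measure_def)

lemma m_Un: "A \<in> sets N \<Longrightarrow> B \<in> sets N \<Longrightarrow> A \<inter> B = {} \<Longrightarrow> m (A \<union> B) = m A + m B"
  using signed_measure_Un[OF signed, of A B] by (simp add: mu_eq_m)

lemma m_Diff: "A \<in> sets N \<Longrightarrow> B \<in> sets N \<Longrightarrow> B \<subseteq> A \<Longrightarrow> m (A - B) = m A - m B"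
  using m_Un[of B "A - B"] by (simp add: Un_absorb1)

lemma m_sums: 
  assumes "range A \<subseteq> sets N" "disjoint_family A"
  shows "(\<lambda>i. m (A i)) sums m (\<Union>i. A i)"
proof -
  have "(\<lambda>i. \<mu> (A i)) sums \<mu> (\<Union>i. A i)" using signed assms by (simp add: signed_measure_def)
  moreover have "(\<lambda>i. \<mu> (A i)) = (\<lambda>i. ereal (m (A i)))" using assms by (auto simp: mu_eq_m)
  moreover have "\<mu> (\<Union>i. A i) = ereal (m (\<Union>i. A i))" using assms by (intro mu_eq_m) auto
  ultimately show ?thesis by (simp add: sums_ereal)
qed

text \<open>Lets every statement on the positive variation be reused for the negative one.\<close>

lemma uminus: "finite_signed_measure N (\<lambda>A. - \<mu> A)"
proof
  have "(\<lambda>i. - \<mu> (A i)) sums (- \<mu> (\<Union>i. A i))" if "range A \<subseteq> sets N" "disjoint_family A" for A :: "nat \<Rightarrow> 'b set"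
  proof -
    have "(\<lambda>i. - m (A i)) sums (- m (\<Union>i. A i))" by (intro sums_minus m_sums that)
    moreover have "(\<lambda>i. - \<mu> (A i)) = (\<lambda>i. ereal (- m (A i)))" using that by (auto simp: mu_eq_m)
    moreover have "- \<mu> (\<Union>i. A i) = ereal (- m (\<Union>i. A i))" using that by (subst mu_eq_m) auto
    ultimately show ?thesis by (simp only: sums_ereal)
  qed
  moreover have "- \<mu> A \<noteq> \<infinity>" if "A \<in> sets N" for A using that by (simp add: mu_eq_m)
  ultimately show "signed_measure N (\<lambda>A. - \<mu> A)"
    using signed by (auto simp: signed_measure_def)
  show "\<bar>- \<mu> (space N)\<bar> \<noteq> \<infinity>" using finite_space by simp
qed

text \<open>The set function inside \<open>pos_variation\<close>. It is the value of that measure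
  only once countable additivity is known, since \<open>measure_of\<close> yields the null measure
  otherwise.\<close>

definition upper_var :: "'b set \<Rightarrow> ennreal" where
  "upper_var A = (SUP B\<in>{B \<in> sets N. B \<subseteq> A}. e2ennreal (\<mu> B))"

lemma upper_var_upper: "B \<in> sets N \<Longrightarrow> B \<subseteq> A \<Longrightarrow> ennreal (m B) \<le> upper_var A"
  unfolding upper_var_def by (intro SUP_upper2[of B]) (auto simp: mu_eq_m)

lemma upper_var_least: 
  assumes "\<And>B. B \<in> sets N \<Longrightarrow> B \<subseteq> A \<Longrightarrow> ennreal (m B) \<le> c"
  shows "upper_var A \<le> c"
  unfolding upper_var_def using assms by (intro SUP_least) (auto simp: mu_eq_m)

lemma upper_var_empty: "upper_var {} = 0"
  using upper_var_least[of "{}" 0] by (simp add: m_empty)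

lemma upper_var_mono: "A \<subseteq> B \<Longrightarrow> upper_var A \<le> upper_var B"
  by (rule upper_var_least) (auto intro: upper_var_upper)

lemma upper_var_superadd:
  assumes "A \<in> sets N" "B \<in> sets N" "A \<inter> B = {}"
  shows "upper_var A + upper_var B \<le> upper_var (A \<union> B)"
proof -
  have *: "ennreal (m C) + ennreal (m D) \<le> upper_var (A \<union> B)" 
    if CD: "C \<in> sets N" "C \<subseteq> A" "D \<in> sets N" "D \<subseteq> B" for C D
  proof -
    \<comment> \<open>Conversion to \<open>ennreal\<close> cuts negative values off at 0, and the
      value 0 is attained by the empty set. The sum is thus the value of \<open>m\<close> at a
      single subset of \<open>A \<union> B\<close>.\<close>
    have "ennreal (m C) + ennreal (m D) = ennreal (max 0 (m C) + max 0 (m D))"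
      by (simp add: ennreal_plus ennreal_neg max_def)
    also have "max 0 (m C) = m (if m C \<ge> 0 then C else {})" by (simp add: m_empty)
    also have "max 0 (m D) = m (if m D \<ge> 0 then D else {})" by (simp add: m_empty)
    also have "m (if m C \<ge> 0 then C else {}) + m (if m D \<ge> 0 then D else {})
        = m ((if m C \<ge> 0 then C else {}) \<union> (if m D \<ge> 0 then D else {}))"
      using CD assms by (intro m_Un[symmetric]) auto
    also have "ennreal \<dots> \<le> upper_var (A \<union> B)" using CD by (intro upper_var_upper) auto
    finally show ?thesis .
  qed
  have e: "{C \<in> sets N. C \<subseteq> X} \<noteq> {}" for X by auto
  have "upper_var A + upper_var B = (SUP D\<in>{D \<in> sets N. D \<subseteq> B}. SUP C\<in>{C \<in> sets N. C \<subseteq> A}. e2ennreal (\<mu> C) + e2ennreal (\<mu> D))"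
    unfolding upper_var_def ennreal_SUP_add_left[OF e, symmetric] ennreal_SUP_add_right[OF e] ..
  also have "\<dots> \<le> upper_var (A \<union> B)" using * by (intro SUP_least) (auto simp: mu_eq_m)
  finally show ?thesis .
qed

lemma upper_var_sum:
  fixes A :: "nat \<Rightarrow> 'b set"
  assumes "range A \<subseteq> sets N" "disjoint_family A"
  shows "(\<Sum>i<n. upper_var (A i)) \<le> upper_var (\<Union>i<n. A i)"
proof (induction n)
  case (Suc n)
  have "A i \<inter> A n = {}" if "i < n" for i using assms(2) that by (simp add: disjoint_family_on_def)
  then have disj: "(\<Union>i<n. A i) \<inter> A n = {}" by auto
  have "(\<Sum>i<Suc n. upper_var (A i)) \<le> upper_var (\<Union>i<n. A i) + upper_var (A n)" using Suc by (simp add: add_right_mono)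
  also have "\<dots> \<le> upper_var ((\<Union>i<n. A i) \<union> A n)"
    using assms disj by (intro upper_var_superadd) auto
  finally show ?case by (simp add: lessThan_Suc Un_commute)
qed (simp add: upper_var_empty)

text \<open>Superadditivity on finite unions gives one inequality. For the other, a set B inside the
  union is cut into the pieces B \<inter> A i; their measures may have mixed signs, so partial sums
  are first bounded by those of the positive parts and only then passed to the limit.\<close>

lemma upper_var_countably_additive: "countably_additive (sets N) upper_var"
proof (rule countably_additiveI)
  fix A :: "nat \<Rightarrow> 'b set"
  assume A: "range A \<subseteq> sets N" "disjoint_family A"
  show "(\<Sum>i. upper_var (A i)) = upper_var (\<Union>i. A i)"
  proof (rule antisym)
    show "(\<Sum>i. upper_var (A i)) \<le> upper_var (\<Union>i. A i)"
    proof (rule suminf_le_const)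
      fix n show "(\<Sum>i<n. upper_var (A i)) \<le> upper_var (\<Union>i. A i)"
        using upper_var_sum[OF A] by (rule order_trans) (auto intro: upper_var_mono)
    qed simp
    show "upper_var (\<Union>i. A i) \<le> (\<Sum>i. upper_var (A i))"
    proof (rule upper_var_least)
      fix B assume B: "B \<in> sets N" "B \<subseteq> (\<Union>i. A i)"
      have "(\<lambda>i. m (B \<inter> A i)) sums m (\<Union>i. B \<inter> A i)"
        using A B by (intro m_sums) (auto simp: disjoint_family_on_def)
      also have "(\<Union>i. B \<inter> A i) = B" using B by auto
      finally have "(\<lambda>n. \<Sum>i<n. m (B \<inter> A i)) \<longlonglongrightarrow> m B" by (simp add: sums_def)
      then have "(\<lambda>n. ennreal (\<Sum>i<n. m (B \<inter> A i))) \<longlonglongrightarrow> ennreal (m B)" by (rule tendsto_ennrealI)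
      then show "ennreal (m B) \<le> (\<Sum>i. upper_var (A i))"
      proof (rule LIMSEQ_le_const2, intro exI allI impI)
        fix n
        have "ennreal (\<Sum>i<n. m (B \<inter> A i)) \<le> ennreal (\<Sum>i<n. max 0 (m (B \<inter> A i)))"
          by (intro ennreal_leI sum_mono) simp
        also have "\<dots> = (\<Sum>i<n. ennreal (max 0 (m (B \<inter> A i))))" by (rule sum_ennreal[symmetric]) simp
        also have "\<dots> \<le> (\<Sum>i<n. upper_var (A i))"
        proof (rule sum_mono)
          fix i show "ennreal (max 0 (m (B \<inter> A i))) \<le> upper_var (A i)"
            using upper_var_upper[of "B \<inter> A i" "A i"] A B by (auto simp: max_def)
        qed
        also have "\<dots> \<le> (\<Sum>i. upper_var (A i))" by (rule sum_le_suminf) auto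
        finally show "ennreal (\<Sum>i<n. m (B \<inter> A i)) \<le> (\<Sum>i. upper_var (A i))" .
      qed
    qed
  qed
qed

lemma sets_pos [simp, measurable_cong]: "sets (pos_variation N \<mu>) = sets N"
  by (simp add: pos_variation_def)

lemma space_pos [simp]: "space (pos_variation N \<mu>) = space N"
  by (simp add: pos_variation_def)

lemma emeasure_pos: "A \<in> sets N \<Longrightarrow> emeasure (pos_variation N \<mu>) A = upper_var A"
  using upper_var_countably_additive
  by (subst emeasure_measure_of[of "pos_variation N \<mu>" "space N" "sets N" upper_var])
    (auto simp: pos_variation_def upper_var_def[symmetric] positive_def upper_var_empty dest: sets.sets_into_space)

text \<open>If the variation of \<open>E\<close> is infinite, \<open>E\<close> splits into two sets of large measure, one of which
  again has infinite variation; iterating gives disjoint sets whose measures are not summable.\<close>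

lemma upper_var_split:
  assumes E: "E \<in> sets N" and inf: "upper_var E = \<infinity>"
  obtains B where "B \<in> sets N" "B \<subseteq> E" "upper_var B = \<infinity>" "1 \<le> \<bar>m (E - B)\<bar>"
proof -
  \<comment> \<open>The excess 1 + |m E| makes both pieces large: m B > 1 and m (E - B) = m E - m B
    < -1. Either of them may therefore be the one that is discarded.\<close>
  have "ennreal (1 + \<bar>m E\<bar>) < upper_var E" unfolding inf by simp
  then obtain B where B: "B \<in> sets N" "B \<subseteq> E" "ennreal (1 + \<bar>m E\<bar>) < ennreal (m B)"
    unfolding upper_var_def by (auto simp: less_SUP_iff mu_eq_m)
  from B have mB: "1 + \<bar>m E\<bar> < m B" by (subst (asm) ennreal_less_iff) simp_all
  \<comment> \<open>Subadditivity for this single cut: the infinite variation of \<open>E\<close>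
    must survive in \<open>B\<close> or in \<open>E - B\<close>.\<close>
  have "upper_var E \<le> upper_var B + upper_var (E - B)"
  proof (rule upper_var_least)
    fix C assume C: "C \<in> sets N" "C \<subseteq> E"
    have "C = C \<inter> B \<union> (C - B)" by auto
    then have "m C = m (C \<inter> B) + m (C - B)" using C B by (metis Int_Diff_disjoint m_Un sets.Diff sets.Int)
    then have "ennreal (m C) \<le> ennreal (max 0 (m (C \<inter> B)) + max 0 (m (C - B)))" by (intro ennreal_leI) auto
    also have "\<dots> = ennreal (m (C \<inter> B)) + ennreal (m (C - B))"
      by (simp add: ennreal_plus max_def ennreal_neg)
    also have "\<dots> \<le> upper_var B + upper_var (E - B)" using B C by (intro add_mono upper_var_upper) auto
    finally show "ennreal (m C) \<le> upper_var B + upper_var (E - B)" .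
  qed
  with inf have "upper_var B = \<infinity> \<or> upper_var (E - B) = \<infinity>" by (simp add: top_unique ennreal_add_eq_top)
  then show ?thesis
  proof
    assume "upper_var B = \<infinity>"
    moreover have "1 \<le> \<bar>m (E - B)\<bar>" using mB m_Diff[OF E B(1,2)] by linarith
    ultimately show ?thesis using that B by blast
  next
    assume "upper_var (E - B) = \<infinity>"
    moreover have "E - (E - B) = B" using B by auto
    ultimately show ?thesis using that[of "E - B"] B E mB by auto
  qed
qed

text \<open>Finite values on sets thus yield finite variation, which later places every bounded
  measurable integrand in the space.\<close>

lemma upper_var_space_finite: "upper_var (space N) \<noteq> \<infinity>"
proof
  assume inf: "upper_var (space N) = \<infinity>"
  have "\<exists>E. \<forall>n::nat. (E n \<in> sets N \<and> upper_var (E n) = \<infinity>) \<and> (E (Suc n) \<subseteq> E n \<and> 1 \<le> \<bar>m (E n - E (Suc n))\<bar>)"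
  proof (rule dependent_nat_choice)
    show "\<exists>E. E \<in> sets N \<and> upper_var E = \<infinity>" using inf by blast
    show "\<exists>B. (B \<in> sets N \<and> upper_var B = \<infinity>) \<and> B \<subseteq> E \<and> 1 \<le> \<bar>m (E - B)\<bar>" if "E \<in> sets N \<and> upper_var E = \<infinity>" for E
      using that upper_var_split[of E] by metis
  qed
  then obtain E where E: "\<And>n. E n \<in> sets N" "\<And>n. E (Suc n) \<subseteq> E n" "\<And>n. 1 \<le> \<bar>m (E n - E (Suc n))\<bar>"
    by metis
  have dec: "E j \<subseteq> E i" if "i \<le> j" for i j using E(2) that by (rule lift_Suc_antimono_le)
  have "disjoint_family (\<lambda>n. E n - E (Suc n))"
    unfolding disjoint_family_on_def
  proof safe
    fix i j x assume "i \<noteq> j" and x: "x \<in> E i" "x \<notin> E (Suc i)" "x \<in> E j" "x \<notin> E (Suc j)"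
    then have "Suc i \<le> j \<or> Suc j \<le> i" by linarith
    then show "x \<in> {}" using x dec by blast
  qed
  then have "(\<lambda>n. m (E n - E (Suc n))) sums m (\<Union>n. E n - E (Suc n))"
    using E(1) by (intro m_sums) auto
  then have "(\<lambda>n. m (E n - E (Suc n))) \<longlonglongrightarrow> 0"
    by (intro summable_LIMSEQ_zero) (rule sums_summable)
  then have "\<forall>\<^sub>F n in sequentially. \<bar>m (E n - E (Suc n))\<bar> < 1"
    by (simp add: tendsto_iff dist_real_def)
  then show False using E(3) by (auto simp: eventually_sequentially not_less[symmetric])
qed

lemma finite_measure_pos: "finite_measure (pos_variation N \<mu>)"
  by standard (use upper_var_space_finite in \<open>simp add: emeasure_pos\<close>)

end

section \<open>Negative variation, Jordan decomposition and total variation\<close>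

context finite_signed_measure
begin

interpretation minus: finite_signed_measure N "\<lambda>A. - \<mu> A"
  by (rule uminus)

lemma sets_neg [simp, measurable_cong]: "sets (neg_variation N \<mu>) = sets N"
  and space_neg [simp]: "space (neg_variation N \<mu>) = space N"
  and finite_measure_neg: "finite_measure (neg_variation N \<mu>)"
  by (simp_all add: neg_variation_def minus.finite_measure_pos)

text \<open>For B inside A, -m B = m (A - B) - m A is at most the positive variation of A minus m A;
  the supremum over B bounds the negative variation of A. This is one inequality, proved for an
  arbitrary \<nu> because the reverse one is its instance for -\<mu>.\<close>

lemma Jordan_decomposition:
  assumes A: "A \<in> sets N"
  shows "m A = measure (pos_variation N \<mu>) A - measure (neg_variation N \<mu>) A"
proof -
  interpret P: finite_measure "pos_variation N \<mu>" by (rule finite_measure_pos)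
  interpret Q: finite_measure "neg_variation N \<mu>" by (rule finite_measure_neg)
  have le: "real_of_ereal (\<nu> A) \<le> measure (pos_variation N \<nu>) A - measure (pos_variation N (\<lambda>A. - \<nu> A)) A" 
    if "finite_signed_measure N \<nu>" for \<nu>
  proof -
    interpret S: finite_signed_measure N \<nu> by fact
    interpret S': finite_signed_measure N "\<lambda>A. - \<nu> A" by (rule S.uminus)
    interpret P: finite_measure "pos_variation N \<nu>" by (rule S.finite_measure_pos)
    interpret Q: finite_measure "pos_variation N (\<lambda>A. - \<nu> A)" by (rule S'.finite_measure_pos)
    have "S'.upper_var A \<le> ennreal (measure (pos_variation N \<nu>) A - S.m A)"
    proof (rule S'.upper_var_least)
      fix B assume B: "B \<in> sets N" "B \<subseteq> A"
      have "ennreal (S.m (A - B)) \<le> ennreal (measure (pos_variation N \<nu>) A)"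
        using S.upper_var_upper[of "A - B" A] A B by (simp add: S.emeasure_pos[symmetric] P.emeasure_eq_measure)
      then have "S.m (A - B) \<le> measure (pos_variation N \<nu>) A"
        by (simp add: ennreal_le_iff)
      then show "ennreal (S'.m B) \<le> ennreal (measure (pos_variation N \<nu>) A - S.m A)"
        using S.m_Diff[OF A B] by (intro ennreal_leI) (simp add: S'.m_def S.m_def)
    qed
    moreover have "0 \<le> measure (pos_variation N \<nu>) A - S.m A"
    proof -
      have "ennreal (S.m A) \<le> ennreal (measure (pos_variation N \<nu>) A)"
        using S.upper_var_upper[of A A] A by (simp add: S.emeasure_pos[symmetric] P.emeasure_eq_measure)
      then show ?thesis by (simp add: ennreal_le_iff)
    qed
    ultimately have "measure (pos_variation N (\<lambda>A. - \<nu> A)) A \<le> measure (pos_variation N \<nu>) A - S.m A"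
      using A by (simp add: S'.emeasure_pos[symmetric] Q.emeasure_eq_measure ennreal_le_iff)
    then show ?thesis by (simp add: S.m_def)
  qed
  from le[of \<mu>] le[OF uminus] show ?thesis
    by (simp add: m_def neg_variation_def finite_signed_measure_axioms)
qed

lemma sets_total [simp, measurable_cong]: "sets (total_variation N \<mu>) = sets N"
  and space_total [simp]: "space (total_variation N \<mu>) = space N"
  by (simp_all add: total_variation_def)

lemma emeasure_total:
  assumes "A \<in> sets N"
  shows "emeasure (total_variation N \<mu>) A = emeasure (pos_variation N \<mu>) A + emeasure (neg_variation N \<mu>) A"
proof (subst emeasure_measure_of[of "total_variation N \<mu>" "space N" "sets N" 
      "\<lambda>A. emeasure (pos_variation N \<mu>) A + emeasure (neg_variation N \<mu>) A"])
  show "countably_additive (sets (total_variation N \<mu>)) 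
      (\<lambda>A. emeasure (pos_variation N \<mu>) A + emeasure (neg_variation N \<mu>) A)"
    by (rule countably_additiveI) (simp add: suminf_add[symmetric] suminf_emeasure)
qed (use assms in \<open>auto simp: total_variation_def positive_def dest: sets.sets_into_space\<close>)

lemma finite_measure_total: "finite_measure (total_variation N \<mu>)"
proof
  show "emeasure (total_variation N \<mu>) (space (total_variation N \<mu>)) \<noteq> \<infinity>"
    using finite_measure.finite_emeasure_space[OF finite_measure_pos] 
      finite_measure.finite_emeasure_space[OF finite_measure_neg]
    by (simp add: emeasure_total)
qed

lemma nn_integral_pos_le_total: "(\<integral>\<^sup>+x. g x \<partial>pos_variation N \<mu>) \<le> (\<integral>\<^sup>+x. g x \<partial>total_variation N \<mu>)"
  and nn_integral_neg_le_total: "(\<integral>\<^sup>+x. g x \<partial>neg_variation N \<mu>) \<le> (\<integral>\<^sup>+x. g x \<partial>total_variation N \<mu>)"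
  by (intro nn_integral_mono_measure; auto simp: le_measure emeasure_total)+

end

section \<open>The space of integrands\<close>

locale covariance_space = finite_signed_measure "square_borel T" \<mu>
  for T :: real and \<mu> :: "(real \<times> real) set \<Rightarrow> ereal" +
  assumes T_nonneg: "0 \<le> T" and L_linear: "L_space_linear T \<mu>"
begin

abbreviation "L \<equiv> L_space T \<mu>"
abbreviation "\<mu>_pos \<equiv> pos_variation (square_borel T) \<mu>"
abbreviation "\<mu>_neg \<equiv> neg_variation (square_borel T) \<mu>"

lemma L_measurable: "\<phi> \<in> L \<Longrightarrow> \<phi> \<in> borel_measurable (restrict_space borel {0..T})"
  by (simp add: L_space_def)

lemma space_square: "space (square_borel T) = {0..T} \<times> {0..T}"
  by (simp add: space_restrict_space)

lemma measurable_tensor: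
  fixes \<phi> \<psi> :: "real \<Rightarrow> real"
  assumes [measurable]: "\<phi> \<in> borel_measurable (restrict_space borel {0..T})" "\<psi> \<in> borel_measurable (restrict_space borel {0..T})"
  shows "(\<lambda>(u, v). \<phi> u * \<psi> v) \<in> borel_measurable (square_borel T)"
proof -
  have [measurable]: "fst \<in> measurable (square_borel T) (restrict_space borel {0..T})"
       "snd \<in> measurable (square_borel T) (restrict_space borel {0..T})"
    by (auto intro!: measurable_restrict_space3 borel_measurable_continuous_onI continuous_intros)
  show ?thesis unfolding split_beta by measurable
qed

lemma L_dominated:
  assumes g: "g \<in> L" and \<phi>: "\<phi> \<in> borel_measurable (restrict_space borel {0..T})"
    and le: "\<And>u. u \<in> {0..T} \<Longrightarrow> \<bar>\<phi> u\<bar> \<le> \<bar>g u\<bar>"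
  shows "\<phi> \<in> L"
proof -
  have "(\<integral>\<^sup>+ (u, v). ennreal (\<bar>\<phi> u\<bar> * \<bar>\<phi> v\<bar>) \<partial>total_variation (square_borel T) \<mu>)
      \<le> (\<integral>\<^sup>+ (u, v). ennreal (\<bar>g u\<bar> * \<bar>g v\<bar>) \<partial>total_variation (square_borel T) \<mu>)"
    by (intro nn_integral_mono) (auto simp: space_square intro!: ennreal_leI mult_mono le)
  also have "\<dots> < \<infinity>" using g by (simp add: L_space_def)
  finally show ?thesis using \<phi> by (simp add: L_space_def)
qed

text \<open>Constants are admissible integrands because the total variation is finite; domination
  does the rest.\<close>

lemma L_bounded:
  assumes \<phi>: "\<phi> \<in> borel_measurable (restrict_space borel {0..T})" and B: "\<And>u. u \<in> {0..T} \<Longrightarrow> \<bar>\<phi> u\<bar> \<le> B"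
  shows "\<phi> \<in> L"
proof (rule L_dominated[OF _ \<phi>])
  interpret finite_measure "total_variation (square_borel T) \<mu>" by (rule finite_measure_total)
  have "emeasure (total_variation (square_borel T) \<mu>) ({0..T} \<times> {0..T}) < top"
    using emeasure_finite by (rule less_top[THEN iffD1])
  then have "ennreal (\<bar>B\<bar> * \<bar>B\<bar>) * emeasure (total_variation (square_borel T) \<mu>) ({0..T} \<times> {0..T}) < \<infinity>"
    unfolding ennreal_mult_less_top infinity_ennreal_def by (intro disjI2 conjI ennreal_less_top)
  then show "(\<lambda>u. B) \<in> L"
    unfolding L_space_def case_prod_beta' by (simp add: space_square)
  show "\<bar>\<phi> u\<bar> \<le> \<bar>B\<bar>" if "u \<in> {0..T}" for u using B[OF that] by linarith
qed

lemma L_lin: "\<phi> \<in> L \<Longrightarrow> \<psi> \<in> L \<Longrightarrow> (\<lambda>u. a * \<phi> u + b * \<psi> u) \<in> L"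
  using L_linear by (simp add: L_space_linear_def)

lemma L_abs: "\<phi> \<in> L \<Longrightarrow> (\<lambda>u. \<bar>\<phi> u\<bar>) \<in> L"
  using L_measurable[of \<phi>] by (rule_tac L_dominated[of \<phi>]) auto

lemma L_indicator: "A \<in> sets borel \<Longrightarrow> indicator A \<in> L"
  by (rule L_bounded[of _ 1]) (auto intro!: measurable_restrict_space1 simp: indicator_def)

lemma L_zero: "(\<lambda>u. 0) \<in> L"
  by (rule L_bounded[of _ 0]) auto

lemma L_sum: "finite I \<Longrightarrow> (\<And>i. i \<in> I \<Longrightarrow> \<phi> i \<in> L) \<Longrightarrow> (\<lambda>u. \<Sum>i\<in>I. c i * \<phi> i u) \<in> L"
proof (induction I rule: finite_induct)
  case (insert i I)
  then show ?case using L_lin[of "\<phi> i" "\<lambda>u. \<Sum>i\<in>I. c i * \<phi> i u" "c i" 1] by simp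
qed (simp add: L_zero)

text \<open>The product |\<phi>(u)| |\<psi>(v)| is at most g(u) g(v) for g = |\<phi>| + |\<psi>|,
  and linearity of the space is exactly what makes g admissible.\<close>

lemma integrable_tensor:
  assumes \<phi>: "\<phi> \<in> L" and \<psi>: "\<psi> \<in> L"
  shows "integrable \<mu>_pos (\<lambda>(u, v). \<phi> u * \<psi> v)" "integrable \<mu>_neg (\<lambda>(u, v). \<phi> u * \<psi> v)"
proof -
  define g where "g u = 1 * \<bar>\<phi> u\<bar> + 1 * \<bar>\<psi> u\<bar>" for u
  have g: "g \<in> L" unfolding g_def by (intro L_lin L_abs \<phi> \<psi>)
  have meas: "(\<lambda>(u, v). \<phi> u * \<psi> v) \<in> borel_measurable (square_borel T)"
    using \<phi> \<psi> by (intro measurable_tensor L_measurable)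
  have "(\<integral>\<^sup>+x. ennreal (norm (case x of (u, v) \<Rightarrow> \<phi> u * \<psi> v)) \<partial>total_variation (square_borel T) \<mu>)
      \<le> (\<integral>\<^sup>+(u, v). ennreal (\<bar>g u\<bar> * \<bar>g v\<bar>) \<partial>total_variation (square_borel T) \<mu>)"
    by (intro nn_integral_mono) (auto simp: g_def abs_mult intro!: ennreal_leI mult_mono)
  also have "\<dots> < \<infinity>" using g by (simp add: L_space_def)
  finally have fin: "(\<integral>\<^sup>+x. ennreal (norm (case x of (u, v) \<Rightarrow> \<phi> u * \<psi> v)) \<partial>total_variation (square_borel T) \<mu>) < \<infinity>" .
  show "integrable \<mu>_pos (\<lambda>(u, v). \<phi> u * \<psi> v)"
    using meas nn_integral_pos_le_total[THEN le_less_trans, OF fin] 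
    by (simp add: integrable_iff_bounded cong: measurable_cong_sets)
  show "integrable \<mu>_neg (\<lambda>(u, v). \<phi> u * \<psi> v)"
    using meas nn_integral_neg_le_total[THEN le_less_trans, OF fin] 
    by (simp add: integrable_iff_bounded cong: measurable_cong_sets)
qed

lemma H_inner_lin_left:
  assumes "\<phi> \<in> L" "\<psi> \<in> L" "\<xi> \<in> L"
  shows "H_inner T \<mu> (\<lambda>u. a * \<phi> u + b * \<psi> u) \<xi> = a * H_inner T \<mu> \<phi> \<xi> + b * H_inner T \<mu> \<psi> \<xi>"
proof -
  have eq: "(\<lambda>(u, v). (a * \<phi> u + b * \<psi> u) * \<xi> v) = (\<lambda>x. a * (case x of (u, v) \<Rightarrow> \<phi> u * \<xi> v) + b * (case x of (u, v) \<Rightarrow> \<psi> u * \<xi> v))"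
    by (auto simp: algebra_simps)
  show ?thesis
    using integrable_tensor[of \<phi> \<xi>] integrable_tensor[of \<psi> \<xi>] assms
    unfolding H_inner_def signed_integral_def eq by (simp add: algebra_simps)
qed

lemma H_inner_lin_right:
  assumes "\<phi> \<in> L" "\<psi> \<in> L" "\<xi> \<in> L"
  shows "H_inner T \<mu> \<xi> (\<lambda>u. a * \<phi> u + b * \<psi> u) = a * H_inner T \<mu> \<xi> \<phi> + b * H_inner T \<mu> \<xi> \<psi>"
proof -
  have eq: "(\<lambda>(u, v). \<xi> u * (a * \<phi> v + b * \<psi> v)) = (\<lambda>x. a * (case x of (u, v) \<Rightarrow> \<xi> u * \<phi> v) + b * (case x of (u, v) \<Rightarrow> \<xi> u * \<psi> v))"
    by (auto simp: algebra_simps)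
  show ?thesis
    using integrable_tensor[of \<xi> \<phi>] integrable_tensor[of \<xi> \<psi>] assms
    unfolding H_inner_def signed_integral_def eq by (simp add: algebra_simps)
qed

lemma H_inner_zero_left: "H_inner T \<mu> (\<lambda>u. 0) \<xi> = 0"
  unfolding H_inner_def signed_integral_def case_prod_beta' by simp

lemma H_inner_sum_left:
  assumes "finite I" "\<And>i. i \<in> I \<Longrightarrow> \<phi> i \<in> L" "\<xi> \<in> L"
  shows "H_inner T \<mu> (\<lambda>u. \<Sum>i\<in>I. c i * \<phi> i u) \<xi> = (\<Sum>i\<in>I. c i * H_inner T \<mu> (\<phi> i) \<xi>)"
  using assms
proof (induction I rule: finite_induct)
  case (insert i I)
  then show ?case 
    using H_inner_lin_left[of "\<phi> i" "\<lambda>u. \<Sum>i\<in>I. c i * \<phi> i u" \<xi> "c i" 1] by (simp add: L_sum)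
qed (simp add: H_inner_zero_left)

text \<open>Dominated convergence for both Jordan parts, with g(u) k(v) as the integrable
  bound.\<close>

lemma H_inner_tendsto:
  assumes "\<And>n. \<phi> n \<in> L" "\<phi>' \<in> L" "\<And>n. \<psi> n \<in> L" "\<psi>' \<in> L" and g: "g \<in> L" "k \<in> L"
    and dom: "\<And>n u. u \<in> {0..T} \<Longrightarrow> \<bar>\<phi> n u\<bar> \<le> g u" "\<And>n u. u \<in> {0..T} \<Longrightarrow> \<bar>\<psi> n u\<bar> \<le> k u"
    and lim: "\<And>u. u \<in> {0..T} \<Longrightarrow> (\<lambda>n. \<phi> n u) \<longlonglongrightarrow> \<phi>' u" "\<And>u. u \<in> {0..T} \<Longrightarrow> (\<lambda>n. \<psi> n u) \<longlonglongrightarrow> \<psi>' u"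
  shows "(\<lambda>n. H_inner T \<mu> (\<phi> n) (\<psi> n)) \<longlonglongrightarrow> H_inner T \<mu> \<phi>' \<psi>'"
proof -
  have *: "(\<lambda>n. \<integral>x. (case x of (u, v) \<Rightarrow> \<phi> n u * \<psi> n v) \<partial>P) \<longlonglongrightarrow> (\<integral>x. (case x of (u, v) \<Rightarrow> \<phi>' u * \<psi>' v) \<partial>P)"
    if int: "\<And>\<phi> \<psi>. \<phi> \<in> L \<Longrightarrow> \<psi> \<in> L \<Longrightarrow> integrable P (\<lambda>(u, v). \<phi> u * \<psi> v)" and sp: "space P = {0..T} \<times> {0..T}" for P
  proof (rule integral_dominated_convergence)
    show "integrable P (\<lambda>(u, v). g u * k v)" by (intro int g)
    show "AE x in P. norm (case x of (u, v) \<Rightarrow> \<phi> n u * \<psi> n v) \<le> (case x of (u, v) \<Rightarrow> g u * k v)" for n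
    proof (intro AE_I2)
      fix x assume x: "x \<in> space P"
      obtain u v where uv: "x = (u, v)" by (cases x)
      have "\<bar>\<phi> n u\<bar> * \<bar>\<psi> n v\<bar> \<le> g u * k v"
        using x dom(1)[of u n] dom(2)[of v n] by (intro mult_mono) (auto simp: sp uv)
      then show "norm (case x of (u, v) \<Rightarrow> \<phi> n u * \<psi> n v) \<le> (case x of (u, v) \<Rightarrow> g u * k v)"
        by (simp add: uv abs_mult)
    qed
    show "AE x in P. (\<lambda>n. case x of (u, v) \<Rightarrow> \<phi> n u * \<psi> n v) \<longlonglongrightarrow> (case x of (u, v) \<Rightarrow> \<phi>' u * \<psi>' v)"
      by (intro AE_I2) (auto simp: sp intro!: tendsto_mult lim)
  qed (use int assms in \<open>auto intro: borel_measurable_integrable\<close>)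
  show ?thesis
    unfolding H_inner_def signed_integral_def
    by (intro tendsto_diff * integrable_tensor) (simp_all add: space_square)
qed

lemma H_inner_indicator:
  assumes "s \<in> {0..T}" "t \<in> {0..T}"
  shows "H_inner T \<mu> (indicator {0..s}) (indicator {0..t}) = real_of_ereal (\<mu> ({0..s} \<times> {0..t}))"
proof -
  have S: "{0..s} \<times> {0..t} \<in> sets (square_borel T)"
    using assms by (auto simp: sets_restrict_space_iff closed_Times intro!: borel_closed)
  have "(\<lambda>(u, v). indicator {0..s} u * indicator {0..t} v) = (indicator ({0..s} \<times> {0..t}) :: _ \<Rightarrow> real)"
    by (auto simp: indicator_def)
  then show ?thesis
    using S sets.sets_into_space[OF S]
    by (simp add: H_inner_def signed_integral_def Jordan_decomposition[OF S, unfolded m_def] space_square Int_absorb2)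
qed

text \<open>An induction principle in the style of the monotone class theorem. Limits come with a
  dominating function in \<open>L\<close>, so that the form and the Wiener integral can follow them.
  Convergence is required on [0,T] only, which identifies functions that agree there.\<close>

lemma L_space_induct [consumes 1, case_names interval linear limit]:
  assumes \<phi>: "\<phi> \<in> L"
    and interval: "\<And>t. t \<in> {0..T} \<Longrightarrow> P (indicator {0..t})"
    and linear: "\<And>\<phi> \<psi> a b. \<phi> \<in> L \<Longrightarrow> \<psi> \<in> L \<Longrightarrow> P \<phi> \<Longrightarrow> P \<psi> \<Longrightarrow> P (\<lambda>u. a * \<phi> u + b * \<psi> u)"
    and limit: "\<And>\<phi> \<phi>' g. (\<And>n::nat. \<phi> n \<in> L) \<Longrightarrow> \<phi>' \<in> L \<Longrightarrow> g \<in> L \<Longrightarrow> 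
       (\<And>n u. u \<in> {0..T} \<Longrightarrow> \<bar>\<phi> n u\<bar> \<le> g u) \<Longrightarrow> 
       (\<And>u. u \<in> {0..T} \<Longrightarrow> (\<lambda>n. \<phi> n u) \<longlonglongrightarrow> \<phi>' u) \<Longrightarrow> (\<And>n. P (\<phi> n)) \<Longrightarrow> P \<phi>'"
  shows "P \<phi>"
proof -
  \<comment> \<open>A constant sequence converges on [0,T] to every function that agrees there with
    its terms.\<close>
  have cong: "P \<psi>" if "P \<phi>" "\<phi> \<in> L" "\<psi> \<in> L" "\<And>u. u \<in> {0..T} \<Longrightarrow> \<psi> u = \<phi> u" for \<phi> \<psi>
    using that by (intro limit[of "\<lambda>n. \<phi>" \<psi> "\<lambda>u. \<bar>\<phi> u\<bar>"]) (auto simp: L_abs)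
  have zero: "P (\<lambda>u. 0)"
    using linear[of "indicator {0..0}" "indicator {0..0}" 0 0] interval[of 0] T_nonneg by (simp add: L_indicator)
  have UNIV: "P (indicator UNIV)"
    using interval[of T] T_nonneg 
    by (intro cong[of "indicator {0..T}" "indicator UNIV"]) (auto simp: L_indicator simp del: indicator_UNIV)
  have ind: "P (indicator A)" if "A \<in> sets borel" for A
  proof -
    have S: "sigma_sets UNIV (range (\<lambda>a::real. {..a})) = sets borel" by (simp add: borel_eq_atMost)
    have "Int_stable (range (\<lambda>a::real. {..a}))" by (auto simp: Int_stable_def)
    moreover have "range (\<lambda>a::real. {..a}) \<subseteq> Pow UNIV" by simp
    moreover have "A \<in> sigma_sets UNIV (range (\<lambda>a::real. {..a}))"
      using that S by simp
    ultimately show ?thesis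
    proof (induction rule: sigma_sets_induct_disjoint)
      case (basic A)
      then obtain a where A: "A = {..a}" by auto
      have L: "indicator A \<in> L" unfolding A by (rule L_indicator) simp
      \<comment> \<open>On [0,T] the half-line is empty, the interval [0,a], or everything.\<close>
      consider "a < 0" | "0 \<le> a" "a \<le> T" | "T < a" by linarith
      then show ?case
      proof cases
        case 1
        then show ?thesis by (intro cong[OF zero L_zero L]) (auto simp: A indicator_def)
      next
        case 2
        then show ?thesis 
          by (intro cong[OF interval L_indicator L]) (auto simp: A indicator_def)
      next
        case 3
        then show ?thesis by (intro cong[OF UNIV L_indicator L]) (auto simp: A indicator_def)
      qed
    next
      case empty
      then show ?case using zero by (simp add: indicator_def[abs_def])
    next
      case (compl A)
      have "A \<in> sets borel" using compl S by simp
      then have "P (\<lambda>u. 1 * indicator UNIV u + (- 1) * indicator A u)"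
        using compl by (intro linear UNIV L_indicator) simp_all
      moreover have "(\<lambda>u. 1 * indicator UNIV u + (- 1) * indicator A u) = (indicator (UNIV - A) :: real \<Rightarrow> real)"
        by (auto simp: indicator_def)
      ultimately show ?case by simp
    next
      case (union A)
      have A: "A i \<in> sets borel" for i using union(2) S by auto
      \<comment> \<open>Disjointness turns finite unions into sums of indicators; the full union is
        their limit, dominated by 1.\<close>
      have *: "P (indicator (\<Union>i<n. A i))" for n
      proof (induction n)
        case 0
        then show ?case using zero by (simp add: indicator_def[abs_def])
      next
        case (Suc n)
        have "P (\<lambda>u. 1 * indicator (\<Union>i<n. A i) u + 1 * indicator (A n) u)"
          using Suc union A by (intro linear) (auto intro!: L_indicator)
        moreover have "A i \<inter> A n = {}" if "i < n" for i 
          using union(1) that by (simp add: disjoint_family_on_def)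
        then have "(\<lambda>u. 1 * indicator (\<Union>i<n. A i) u + 1 * indicator (A n) u) = (indicator (\<Union>i<Suc n. A i) :: real \<Rightarrow> real)"
          by (auto simp: indicator_def lessThan_Suc fun_eq_iff)
        ultimately show ?case by simp
      qed
      show ?case
      proof (rule limit[where \<phi>="\<lambda>n. indicator (\<Union>i<n. A i)" and g="indicator UNIV"])
        show "(\<lambda>n. indicator (\<Union>i<n. A i) u :: real) \<longlonglongrightarrow> indicator (\<Union>i. A i) u" for u
          by (rule LIMSEQ_indicator_UN)
      next
        show "indicator (\<Union>i. A i) \<in> L" "indicator UNIV \<in> L" "indicator (\<Union>i<n. A i) \<in> L" for n
          using A by (auto intro!: L_indicator simp del: indicator_UNIV)
      qed (auto intro: * simp: indicator_def)
    qed
  qed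
  have sum: "P (\<lambda>u. \<Sum>y\<in>Y. y * indicator (A y) u)" if "finite Y" and A: "\<And>y. A y \<in> sets borel" for Y A
    using that(1)
  proof (induction Y rule: finite_induct)
    case (insert y Y)
    have "P (\<lambda>u. y * indicator (A y) u + 1 * (\<Sum>y\<in>Y. y * indicator (A y) u))"
      by (intro linear ind L_indicator L_sum A insert)
    then show ?case unfolding sum.insert[OF insert(1,2)] mult_1 .
  qed (simp add: zero)
  \<comment> \<open>Cut off outside [0,T], the function becomes Borel on the whole line. Its simple
    approximations satisfy |F i| \<le> 2 |f|, whence the dominating function 2 |\<phi>|; the summand
    with factor 0 below merely fits the shape of \<open>L_lin\<close>.\<close>
  define f where "f u = indicator {0..T} u *\<^sub>R \<phi> u" for u
  have f[measurable]: "f \<in> borel_measurable borel"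
    unfolding f_def using L_measurable[OF \<phi>] by (subst (asm) borel_measurable_restrict_space_iff) simp_all
  obtain F where F: "\<And>i. simple_function borel (F i)" "\<And>x. (\<lambda>i. F i x) \<longlonglongrightarrow> f x" "\<And>i x. \<bar>F i x\<bar> \<le> 2 * \<bar>f x\<bar>"
    using borel_measurable_implies_sequence_metric[OF f, of 0] by (auto simp: dist_real_def)
  have Fm: "F i \<in> borel_measurable borel" for i using F(1) by (rule borel_measurable_simple_function)
  have PF: "P (F i)" for i
  proof -
    have fin: "finite (range (F i))" using F(1)[of i] by (simp add: simple_function_def)
    then have "P (\<lambda>u. \<Sum>y\<in>range (F i). y * indicator (F i -` {y}) u)"
      using measurable_sets[OF Fm] by (intro sum) auto
    moreover have "(\<Sum>y\<in>range (F i). y * indicator (F i -` {y}) u) = F i u" for u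
    proof -
      have "(\<Sum>y\<in>range (F i). y * indicator (F i -` {y}) u) = (\<Sum>y\<in>range (F i). if y = F i u then y else 0)"
        by (intro sum.cong) (auto simp: indicator_def)
      then show ?thesis using fin by simp
    qed
    ultimately show ?thesis by (simp only:)
  qed
  have g: "(\<lambda>u. 2 * \<bar>\<phi> u\<bar> + 0 * \<bar>\<phi> u\<bar>) \<in> L" by (intro L_lin L_abs \<phi>)
  show ?thesis
  proof (rule limit[OF _ \<phi> g])
    show "\<bar>F n u\<bar> \<le> 2 * \<bar>\<phi> u\<bar> + 0 * \<bar>\<phi> u\<bar>" if "u \<in> {0..T}" for n u
      using F(3)[of n u] that by (simp add: f_def)
    then show "F n \<in> L" for n
      using Fm by (intro L_dominated[OF g]) (auto intro: measurable_restrict_space1 order_trans)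
    show "(\<lambda>n. F n u) \<longlonglongrightarrow> \<phi> u" if "u \<in> {0..T}" for u
      using F(2)[of u] that by (simp add: f_def)
  qed (rule PF)
qed

end

section \<open>The Wiener integral\<close>

lemma integral_Cauchy_Schwarz:
  fixes U Y :: "'a \<Rightarrow> real"
  assumes [measurable]: "U \<in> borel_measurable M" "Y \<in> borel_measurable M"
    and U: "integrable M (\<lambda>x. (U x)\<^sup>2)" and Y: "integrable M (\<lambda>x. (Y x)\<^sup>2)"
  shows "integrable M (\<lambda>x. U x * Y x)" (is ?int)
    and "(\<integral>x. \<bar>U x * Y x\<bar> \<partial>M) \<le> sqrt (\<integral>x. (U x)\<^sup>2 \<partial>M) * sqrt (\<integral>x. (Y x)\<^sup>2 \<partial>M)"
proof -
  show i: ?int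
  proof (rule Bochner_Integration.integrable_bound)
    show "integrable M (\<lambda>x. (U x)\<^sup>2 + (Y x)\<^sup>2)" using U Y by simp
    show "AE x in M. norm (U x * Y x) \<le> norm ((U x)\<^sup>2 + (Y x)\<^sup>2)"
    proof (rule AE_I2)
      fix x
      have "2 * (\<bar>U x\<bar> * \<bar>Y x\<bar>) \<le> (U x)\<^sup>2 + (Y x)\<^sup>2"
        using sum_squares_bound[of "\<bar>U x\<bar>" "\<bar>Y x\<bar>"] by simp
      moreover have "0 \<le> \<bar>U x\<bar> * \<bar>Y x\<bar>" by simp
      ultimately show "norm (U x * Y x) \<le> norm ((U x)\<^sup>2 + (Y x)\<^sup>2)"
        unfolding real_norm_def abs_mult by linarith
    qed
  qed simp
  have "(\<integral>\<^sup>+x. ennreal \<bar>U x\<bar> * ennreal \<bar>Y x\<bar> \<partial>M)\<^sup>2 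
      \<le> (\<integral>\<^sup>+x. (ennreal \<bar>U x\<bar>)\<^sup>2 \<partial>M) * (\<integral>\<^sup>+x. (ennreal \<bar>Y x\<bar>)\<^sup>2 \<partial>M)"
    by (rule Cauchy_Schwarz_nn_integral) simp_all
  also have "(\<integral>\<^sup>+x. ennreal \<bar>U x\<bar> * ennreal \<bar>Y x\<bar> \<partial>M) = ennreal (\<integral>x. \<bar>U x * Y x\<bar> \<partial>M)"
    using i by (simp add: ennreal_mult[symmetric] abs_mult[symmetric] nn_integral_eq_integral)
  also have "(\<integral>\<^sup>+x. (ennreal \<bar>U x\<bar>)\<^sup>2 \<partial>M) = ennreal (\<integral>x. (U x)\<^sup>2 \<partial>M)"
    using U by (simp add: ennreal_power nn_integral_eq_integral)
  also have "(\<integral>\<^sup>+x. (ennreal \<bar>Y x\<bar>)\<^sup>2 \<partial>M) = ennreal (\<integral>x. (Y x)\<^sup>2 \<partial>M)"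
    using Y by (simp add: ennreal_power nn_integral_eq_integral)
  finally have "(\<integral>x. \<bar>U x * Y x\<bar> \<partial>M)\<^sup>2 \<le> (\<integral>x. (U x)\<^sup>2 \<partial>M) * (\<integral>x. (Y x)\<^sup>2 \<partial>M)"
    by (simp add: ennreal_power ennreal_mult[symmetric] ennreal_le_iff)
  then show "(\<integral>x. \<bar>U x * Y x\<bar> \<partial>M) \<le> sqrt (\<integral>x. (U x)\<^sup>2 \<partial>M) * sqrt (\<integral>x. (Y x)\<^sup>2 \<partial>M)"
    by (simp add: real_le_rsqrt real_sqrt_mult[symmetric])
qed

lemma integrable_square_lin:
  fixes U Y :: "'a \<Rightarrow> real"
  assumes "U \<in> borel_measurable M" "Y \<in> borel_measurable M"
    and "integrable M (\<lambda>x. (U x)\<^sup>2)" "integrable M (\<lambda>x. (Y x)\<^sup>2)"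
  shows "integrable M (\<lambda>x. (a * U x + b * Y x)\<^sup>2)"
proof -
  have "(a * U x + b * Y x)\<^sup>2 = a\<^sup>2 * (U x)\<^sup>2 + b\<^sup>2 * (Y x)\<^sup>2 + 2 * a * b * (U x * Y x)" for x
    by (simp add: power2_sum power_mult_distrib)
  then show ?thesis using assms integral_Cauchy_Schwarz(1)[OF assms] by simp
qed

lemma L2_tendsto_inner:
  fixes U :: "nat \<Rightarrow> 'a \<Rightarrow> real" and Y :: "'a \<Rightarrow> real"
  assumes [measurable]: "\<And>n. U n \<in> borel_measurable M" "Y \<in> borel_measurable M"
    and U: "\<And>n. integrable M (\<lambda>x. (U n x)\<^sup>2)" and Y: "integrable M (\<lambda>x. (Y x)\<^sup>2)"
    and lim: "(\<lambda>n. \<integral>x. (U n x)\<^sup>2 \<partial>M) \<longlonglongrightarrow> 0"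
  shows "(\<lambda>n. \<integral>x. U n x * Y x \<partial>M) \<longlonglongrightarrow> 0"
proof (rule Lim_null_comparison)
  show "\<forall>\<^sub>F n in sequentially. norm (\<integral>x. U n x * Y x \<partial>M) \<le> sqrt (\<integral>x. (U n x)\<^sup>2 \<partial>M) * sqrt (\<integral>x. (Y x)\<^sup>2 \<partial>M)"
  proof (intro always_eventually allI)
    fix n
    have "norm (\<integral>x. U n x * Y x \<partial>M) \<le> (\<integral>x. \<bar>U n x * Y x\<bar> \<partial>M)" 
      using integral_norm_bound[of M "\<lambda>x. U n x * Y x"] by simp
    also have "\<dots> \<le> sqrt (\<integral>x. (U n x)\<^sup>2 \<partial>M) * sqrt (\<integral>x. (Y x)\<^sup>2 \<partial>M)"
      by (rule integral_Cauchy_Schwarz(2)) (simp_all add: U Y)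
    finally show "norm (\<integral>x. U n x * Y x \<partial>M) \<le> sqrt (\<integral>x. (U n x)\<^sup>2 \<partial>M) * sqrt (\<integral>x. (Y x)\<^sup>2 \<partial>M)" .
  qed
  show "(\<lambda>n. sqrt (\<integral>x. (U n x)\<^sup>2 \<partial>M) * sqrt (\<integral>x. (Y x)\<^sup>2 \<partial>M)) \<longlonglongrightarrow> 0"
    using tendsto_mult_left_zero[OF tendsto_real_sqrt[OF lim, unfolded real_sqrt_zero]] by simp
qed

section \<open>Moments and characteristic functions of Gaussian variables\<close>

lemma (in prob_space) gaussian_rv_integrable:
  assumes "gaussian_rv M Y"
  shows "integrable M Y" "integrable M (\<lambda>\<omega>. (Y \<omega>)\<^sup>2)"
proof -
  from assms have [measurable]: "Y \<in> borel_measurable M" by (simp add: gaussian_rv_def)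
  from assms obtain m \<sigma> where "(AE \<omega> in M. Y \<omega> = m) \<or> (\<sigma> > 0 \<and> distributed M lborel Y (normal_density m \<sigma>))"
    by (auto simp: gaussian_rv_def)
  then have "integrable M Y \<and> integrable M (\<lambda>\<omega>. (Y \<omega>)\<^sup>2)"
  proof
    assume m: "AE \<omega> in M. Y \<omega> = m"
    show ?thesis
    proof (intro conjI)
      show "integrable M Y" using m by (intro integrable_const_bound[of _ "\<bar>m\<bar>"]) auto
      show "integrable M (\<lambda>\<omega>. (Y \<omega>)\<^sup>2)" using m by (intro integrable_const_bound[of _ "m\<^sup>2"]) auto
    qed
  next
    assume *: "\<sigma> > 0 \<and> distributed M lborel Y (normal_density m \<sigma>)"
    then have D: "distributed M lborel Y (normal_density m \<sigma>)" and \<sigma>: "\<sigma> > 0" by auto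
    have 1: "integrable M Y"
      using integrable_normal_moment_nz_1[OF \<sigma>, of m] distributed_integrable[OF D, of "\<lambda>x. x"] by simp
    have "integrable M (\<lambda>\<omega>. (Y \<omega> - m)\<^sup>2)"
      using integrable_normal_moment[OF \<sigma>, of m 2] distributed_integrable[OF D, of "\<lambda>x. (x - m)\<^sup>2"] by simp
    then have "integrable M (\<lambda>\<omega>. (Y \<omega> - m)\<^sup>2 + 2 * m * Y \<omega> - m\<^sup>2)" using 1 by simp
    moreover have "(y - m)\<^sup>2 + 2 * m * y - m\<^sup>2 = y\<^sup>2" for y by (simp add: power2_diff)
    ultimately show ?thesis using 1 by simp
  qed
  then show "integrable M Y" "integrable M (\<lambda>\<omega>. (Y \<omega>)\<^sup>2)" by auto
qed

text \<open>With mean zero the degenerate case is Y = 0 almost surely, so both cases obey one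
  formula in the second moment.\<close>

lemma (in prob_space) gaussian_rv_char:
  assumes G: "gaussian_rv M Y" and mean: "expectation Y = 0"
  shows "(\<integral>\<omega>. iexp (Y \<omega>) \<partial>M) = complex_of_real (exp (- (\<integral>\<omega>. (Y \<omega>)\<^sup>2 \<partial>M) / 2))"
proof -
  from G have [measurable]: "Y \<in> borel_measurable M" by (simp add: gaussian_rv_def)
  from G obtain m \<sigma> where "(AE \<omega> in M. Y \<omega> = m) \<or> (\<sigma> > 0 \<and> distributed M lborel Y (normal_density m \<sigma>))"
    by (auto simp: gaussian_rv_def)
  then show ?thesis
  proof
    assume m: "AE \<omega> in M. Y \<omega> = m"
    then have "expectation Y = expectation (\<lambda>\<omega>. m)" by (intro integral_cong_AE) auto
    with m mean have Y0: "AE \<omega> in M. Y \<omega> = 0" by (simp add: prob_space)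
    then have "(\<integral>\<omega>. iexp (Y \<omega>) \<partial>M) = (\<integral>\<omega>. 1 \<partial>M)" by (intro integral_cong_AE) auto
    moreover have "(\<integral>\<omega>. (Y \<omega>)\<^sup>2 \<partial>M) = 0" using Y0 by (intro integral_eq_zero_AE) auto
    ultimately show ?thesis by (simp add: prob_space)
  next
    assume *: "\<sigma> > 0 \<and> distributed M lborel Y (normal_density m \<sigma>)"
    then have D: "distributed M lborel Y (normal_density m \<sigma>)" and \<sigma>: "\<sigma> > 0" by auto
    have m: "m = 0" using normal_distributed_expectation[OF \<sigma> D] mean by simp
    have "(\<integral>\<omega>. (Y \<omega>)\<^sup>2 \<partial>M) = \<sigma>\<^sup>2" using normal_distributed_variance[OF \<sigma> D] mean by simp
    then show ?thesis using char_normal[OF D[unfolded m] \<sigma>, of 1] by simp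
  qed
qed

text \<open>Factoring out an exponential of modulus 1 leaves the estimate for the distance of an
  exponential to 1. It makes characteristic functions continuous under convergence in mean.\<close>

lemma norm_iexp_diff_le: "cmod (iexp a - iexp b) \<le> \<bar>a - b\<bar>"
proof -
  have "iexp a - iexp b = iexp b * (iexp (a - b) - 1)"
    by (simp add: right_diff_distrib exp_add[symmetric] algebra_simps)
  then have "cmod (iexp a - iexp b) = cmod (iexp (a - b) - 1)" by (simp add: norm_mult)
  also have "\<dots> \<le> \<bar>a - b\<bar>" using iexp_approx1[of "a - b" 0] by simp
  finally show ?thesis .
qed

section \<open>Continuity and isometry of the Wiener integral\<close>

locale wiener_integral = prob_space M + covariance_space T \<mu>
  for M :: "'a measure" and T and X :: "real \<Rightarrow> 'a \<Rightarrow> real" and \<mu> and W :: "(real \<Rightarrow> real) \<Rightarrow> 'a \<Rightarrow> real" +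
  assumes gaussian: "gaussian_process M {0..T} X"
    and mean_zero: "t \<in> {0..T} \<Longrightarrow> expectation (X t) = 0"
    and covariance_\<mu>: "is_covariance_measure M T X \<mu>"
    and wiener: "is_wiener_integral M T X \<mu> W"
begin

lemma X_measurable [measurable]: "t \<in> {0..T} \<Longrightarrow> X t \<in> borel_measurable M"
  using gaussian by (simp add: gaussian_process_def)

lemma W_measurable [measurable]: "\<phi> \<in> L \<Longrightarrow> W \<phi> \<in> borel_measurable M"
  and W_square_integrable: "\<phi> \<in> L \<Longrightarrow> integrable M (\<lambda>\<omega>. (W \<phi> \<omega>)\<^sup>2)"
  and W_lin: "\<phi> \<in> L \<Longrightarrow> \<psi> \<in> L \<Longrightarrow> AE \<omega> in M. W (\<lambda>u. a * \<phi> u + b * \<psi> u) \<omega> = a * W \<phi> \<omega> + b * W \<psi> \<omega>"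
  and W_X: "t \<in> {0..T} \<Longrightarrow> AE \<omega> in M. W (indicator {0..t}) \<omega> = X t \<omega>"
  using wiener by (auto simp: is_wiener_integral_def)

lemma W_diff_square_integrable:
  "\<phi> \<in> L \<Longrightarrow> \<psi> \<in> L \<Longrightarrow> integrable M (\<lambda>\<omega>. (W \<phi> \<omega> - W \<psi> \<omega>)\<^sup>2)"
  using integrable_square_lin[of "W \<phi>" M "W \<psi>" 1 "- 1"] by (simp add: W_square_integrable)

lemma W_sum:
  assumes "finite I" "\<And>i. i \<in> I \<Longrightarrow> \<phi> i \<in> L"
  shows "AE \<omega> in M. W (\<lambda>u. \<Sum>i\<in>I. c i * \<phi> i u) \<omega> = (\<Sum>i\<in>I. c i * W (\<phi> i) \<omega>)"
  using assms
proof (induction I rule: finite_induct)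
  case empty
  show ?case using W_lin[OF L_zero L_zero, of 0 0] by simp
next
  case (insert i I)
  then have "AE \<omega> in M. W (\<lambda>u. \<Sum>i\<in>I. c i * \<phi> i u) \<omega> = (\<Sum>i\<in>I. c i * W (\<phi> i) \<omega>)" by simp
  moreover have "AE \<omega> in M. W (\<lambda>u. c i * \<phi> i u + 1 * (\<Sum>i\<in>I. c i * \<phi> i u)) \<omega>
      = c i * W (\<phi> i) \<omega> + 1 * W (\<lambda>u. \<Sum>i\<in>I. c i * \<phi> i u) \<omega>"
    using insert by (intro W_lin L_sum) auto
  ultimately show ?case using insert by (auto elim: AE_mp)
qed

text \<open>Continuity of \<open>W\<close> is assumed for the seminorm. The differences \<phi> n -
  \<phi>' tend to 0 pointwise and are dominated by g + |\<phi>'|, so their seminorms tend to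
  0.\<close>

lemma W_tendsto:
  assumes \<phi>: "\<And>n. \<phi> n \<in> L" "\<phi>' \<in> L" and g: "g \<in> L"
    and dom: "\<And>n u. u \<in> {0..T} \<Longrightarrow> \<bar>\<phi> n u\<bar> \<le> g u"
    and lim: "\<And>u. u \<in> {0..T} \<Longrightarrow> (\<lambda>n. \<phi> n u) \<longlonglongrightarrow> \<phi>' u"
  shows "(\<lambda>n. \<integral>\<omega>. (W (\<phi> n) \<omega> - W \<phi>' \<omega>)\<^sup>2 \<partial>M) \<longlonglongrightarrow> 0"
proof -
  define \<psi> where "\<psi> n u = \<phi> n u - \<phi>' u" for n u
  have \<psi>: "\<psi> n \<in> L" for n using L_lin[OF \<phi>(1)[of n] \<phi>(2), of 1 "- 1"] by (simp add: \<psi>_def[abs_def])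
  have gd: "(\<lambda>u. g u + \<bar>\<phi>' u\<bar>) \<in> L" using L_lin[OF g L_abs[OF \<phi>(2)], of 1 1] by simp
  have "(\<lambda>n. H_inner T \<mu> (\<psi> n) (\<psi> n)) \<longlonglongrightarrow> H_inner T \<mu> (\<lambda>u. 0) (\<lambda>u. 0)"
  proof (rule H_inner_tendsto[OF \<psi> L_zero \<psi> L_zero gd gd])
    show "\<bar>\<psi> n u\<bar> \<le> g u + \<bar>\<phi>' u\<bar>" if "u \<in> {0..T}" for n u
      using dom[OF that, of n] by (simp add: \<psi>_def)
    then show "\<bar>\<psi> n u\<bar> \<le> g u + \<bar>\<phi>' u\<bar>" if "u \<in> {0..T}" for n u using that .
    show "(\<lambda>n. \<psi> n u) \<longlonglongrightarrow> 0" if "u \<in> {0..T}" for u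
      using lim[OF that] by (simp add: \<psi>_def LIM_zero)
    then show "(\<lambda>n. \<psi> n u) \<longlonglongrightarrow> 0" if "u \<in> {0..T}" for u using that .
  qed
  then have H: "(\<lambda>n. H_norm T \<mu> (\<psi> n)) \<longlonglongrightarrow> 0"
    unfolding H_inner_zero_left H_norm_def using tendsto_real_sqrt by force
  have "(\<lambda>n. L2_norm_rv M (\<lambda>\<omega>. W (\<phi> n) \<omega> - W \<phi>' \<omega>)) \<longlonglongrightarrow> 0"
  proof (rule LIMSEQ_I)
    fix e :: real assume "0 < e"
    then obtain d where d: "d > 0" "\<And>\<psi>. \<psi> \<in> L \<Longrightarrow> H_norm T \<mu> (\<lambda>u. \<psi> u - \<phi>' u) < d \<Longrightarrow> L2_norm_rv M (\<lambda>\<omega>. W \<psi> \<omega> - W \<phi>' \<omega>) < e"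
      using wiener \<phi>(2) unfolding is_wiener_integral_def by meson
    from LIMSEQ_D[OF H d(1)] obtain N where N: "\<And>n. n \<ge> N \<Longrightarrow> \<bar>H_norm T \<mu> (\<psi> n)\<bar> < d" by auto
    have "0 \<le> L2_norm_rv M Y" for Y by (simp add: L2_norm_rv_def)
    then have "\<forall>n\<ge>N. norm (L2_norm_rv M (\<lambda>\<omega>. W (\<phi> n) \<omega> - W \<phi>' \<omega>) - 0) < e"
      using d(2)[OF \<phi>(1)] N by (force simp: \<psi>_def[abs_def])
    then show "\<exists>N. \<forall>n\<ge>N. norm (L2_norm_rv M (\<lambda>\<omega>. W (\<phi> n) \<omega> - W \<phi>' \<omega>) - 0) < e" ..
  qed
  then have "(\<lambda>n. (L2_norm_rv M (\<lambda>\<omega>. W (\<phi> n) \<omega> - W \<phi>' \<omega>))\<^sup>2) \<longlonglongrightarrow> 0\<^sup>2" by (rule tendsto_power)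
  then show ?thesis by (simp add: L2_norm_rv_def)
qed

lemma W_inner_tendsto:
  assumes \<phi>: "\<And>n. \<phi> n \<in> L" "\<phi>' \<in> L" and g: "g \<in> L"
    and dom: "\<And>n u. u \<in> {0..T} \<Longrightarrow> \<bar>\<phi> n u\<bar> \<le> g u"
    and lim: "\<And>u. u \<in> {0..T} \<Longrightarrow> (\<lambda>n. \<phi> n u) \<longlonglongrightarrow> \<phi>' u" and \<psi>: "\<psi> \<in> L"
  shows "(\<lambda>n. \<integral>\<omega>. W (\<phi> n) \<omega> * W \<psi> \<omega> \<partial>M) \<longlonglongrightarrow> (\<integral>\<omega>. W \<phi>' \<omega> * W \<psi> \<omega> \<partial>M)"
proof -
  have i: "integrable M (\<lambda>\<omega>. W \<phi> \<omega> * W \<psi> \<omega>)" if "\<phi> \<in> L" for \<phi>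
    using that \<psi> by (intro integral_Cauchy_Schwarz(1)) (simp_all add: W_square_integrable)
  have "(\<lambda>n. \<integral>\<omega>. (W (\<phi> n) \<omega> - W \<phi>' \<omega>) * W \<psi> \<omega> \<partial>M) \<longlonglongrightarrow> 0"
    using \<phi> \<psi> by (intro L2_tendsto_inner W_tendsto[OF \<phi> g dom lim] W_diff_square_integrable W_square_integrable) simp_all
  then show ?thesis by (simp add: left_diff_distrib i \<phi> LIM_zero_iff)
qed

lemma W_inner_lin:
  assumes "\<phi> \<in> L" "\<psi> \<in> L" "\<xi> \<in> L"
  shows "(\<integral>\<omega>. W (\<lambda>u. a * \<phi> u + b * \<psi> u) \<omega> * W \<xi> \<omega> \<partial>M)
    = a * (\<integral>\<omega>. W \<phi> \<omega> * W \<xi> \<omega> \<partial>M) + b * (\<integral>\<omega>. W \<psi> \<omega> * W \<xi> \<omega> \<partial>M)"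
proof -
  have i: "integrable M (\<lambda>\<omega>. W \<phi> \<omega> * W \<xi> \<omega>)" if "\<phi> \<in> L" for \<phi>
    using that assms by (intro integral_Cauchy_Schwarz(1)) (simp_all add: W_square_integrable)
  have "(\<integral>\<omega>. W (\<lambda>u. a * \<phi> u + b * \<psi> u) \<omega> * W \<xi> \<omega> \<partial>M)
      = (\<integral>\<omega>. a * (W \<phi> \<omega> * W \<xi> \<omega>) + b * (W \<psi> \<omega> * W \<xi> \<omega>) \<partial>M)"
    using W_lin[OF assms(1,2), of a b] assms 
    by (intro integral_cong_AE) (auto intro!: W_measurable L_lin borel_measurable_times borel_measurable_add simp: algebra_simps elim: AE_mp)
  then show ?thesis by (simp add: i assms)
qed

text \<open>As the process is centred, its covariance is E(X_s X_t), which the covariance measure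
  assigns to the rectangle.\<close>

lemma W_isometry_interval:
  assumes "s \<in> {0..T}" "t \<in> {0..T}"
  shows "(\<integral>\<omega>. W (indicator {0..s}) \<omega> * W (indicator {0..t}) \<omega> \<partial>M) = H_inner T \<mu> (indicator {0..s}) (indicator {0..t})"
proof -
  have "(\<integral>\<omega>. W (indicator {0..s}) \<omega> * W (indicator {0..t}) \<omega> \<partial>M) = (\<integral>\<omega>. X s \<omega> * X t \<omega> \<partial>M)"
    using W_X[OF assms(1)] W_X[OF assms(2)] assms
    by (intro integral_cong_AE) (auto intro!: borel_measurable_times W_measurable L_indicator elim: AE_mp)
  also have "\<dots> = covariance M (X s) (X t)" using assms by (simp add: covariance_def mean_zero)
  also have "\<dots> = real_of_ereal (\<mu> ({0..s} \<times> {0..t}))"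
    using covariance_\<mu> assms by (simp add: is_covariance_measure_def)
  finally show ?thesis using assms by (simp add: H_inner_indicator)
qed

text \<open>Both sides are linear in each argument and follow dominated limits, so agreement spreads
  from intervals to the whole space: over the first argument against a fixed interval, then over the
  second.\<close>

theorem W_isometry:
  assumes \<phi>: "\<phi> \<in> L" and \<psi>: "\<psi> \<in> L"
  shows "(\<integral>\<omega>. W \<phi> \<omega> * W \<psi> \<omega> \<partial>M) = H_inner T \<mu> \<phi> \<psi>"
proof -
  have *: "(\<integral>\<omega>. W \<phi> \<omega> * W (indicator {0..t}) \<omega> \<partial>M) = H_inner T \<mu> \<phi> (indicator {0..t})"
    if t: "t \<in> {0..T}" for t
    using \<phi>
  proof (induction rule: L_space_induct)
    case (interval s)
    then show ?case using t by (rule W_isometry_interval)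
  next
    case (linear \<phi> \<psi> a b)
    then show ?case by (simp add: W_inner_lin H_inner_lin_left L_indicator)
  next
    case (limit \<phi> \<phi>' g)
    have I: "indicator {0..t} \<in> L" by (simp add: L_indicator)
    have "(\<lambda>n. H_inner T \<mu> (\<phi> n) (indicator {0..t})) \<longlonglongrightarrow> H_inner T \<mu> \<phi>' (indicator {0..t})"
      using limit I by (intro H_inner_tendsto[where g=g and k="\<lambda>u. \<bar>indicator {0..t} u\<bar>"]) (auto intro!: L_abs)
    moreover have "(\<lambda>n. \<integral>\<omega>. W (\<phi> n) \<omega> * W (indicator {0..t}) \<omega> \<partial>M) \<longlonglongrightarrow> (\<integral>\<omega>. W \<phi>' \<omega> * W (indicator {0..t}) \<omega> \<partial>M)"
      by (rule W_inner_tendsto[OF limit(1-5) I])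
    ultimately show ?case unfolding limit(6) by (rule LIMSEQ_unique[symmetric])
  qed
  \<comment> \<open>The factors are exchanged because linearity and limits of the expectation were
    established in its first factor.\<close>
  have "(\<integral>\<omega>. W \<psi> \<omega> * W \<phi> \<omega> \<partial>M) = H_inner T \<mu> \<phi> \<psi>"
    using \<psi>
  proof (induction rule: L_space_induct)
    case (interval s)
    then show ?case using *[OF interval] by (simp add: mult.commute)
  next
    case (linear \<psi> \<psi>' a b)
    then show ?case using \<phi> by (simp add: W_inner_lin H_inner_lin_right)
  next
    case (limit \<psi> \<psi>' g)
    have "(\<lambda>n. H_inner T \<mu> \<phi> (\<psi> n)) \<longlonglongrightarrow> H_inner T \<mu> \<phi> \<psi>'"
      using limit \<phi> by (intro H_inner_tendsto[where g="\<lambda>u. \<bar>\<phi> u\<bar>" and k=g]) (auto intro!: L_abs)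
    moreover have "(\<lambda>n. \<integral>\<omega>. W (\<psi> n) \<omega> * W \<phi> \<omega> \<partial>M) \<longlonglongrightarrow> (\<integral>\<omega>. W \<psi>' \<omega> * W \<phi> \<omega> \<partial>M)"
      by (rule W_inner_tendsto[OF limit(1-5) \<phi>])
    ultimately show ?case unfolding limit(6) by (rule LIMSEQ_unique[symmetric])
  qed
  then show ?thesis by (simp add: mult.commute)
qed

end

section \<open>First derivatives of bounded smooth functions\<close>

lemma Cb_infinity_derivatives:
  fixes f :: "real^'n::finite \<Rightarrow> real"
  assumes "f \<in> Cb_infinity"
  shows "f differentiable (at x)" "bounded (range f)" 
    "pderiv_at i f differentiable (at x)" "bounded (range (pderiv_at i f))"
proof -
  have *: "(\<forall>x. foldr pderiv_at js f differentiable (at x)) \<and> bounded (range (foldr pderiv_at js f))" for js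
    using assms by (simp add: Cb_infinity_def)
  from *[of "[]"] *[of "[i]"] show "f differentiable (at x)" "bounded (range f)" 
    "pderiv_at i f differentiable (at x)" "bounded (range (pderiv_at i f))" by auto
qed

lemma frechet_derivative_pderiv_at:
  fixes f :: "real^'n::finite \<Rightarrow> real"
  assumes "f differentiable (at x)"
  shows "frechet_derivative f (at x) k = (\<Sum>i\<in>UNIV. k $ i * pderiv_at i f x)"
proof -
  have lin: "linear (frechet_derivative f (at x))"
    using assms by (rule linear_frechet_derivative)
  have "frechet_derivative f (at x) k = frechet_derivative f (at x) (\<Sum>i\<in>UNIV. k $ i *\<^sub>R axis i 1)"
    by (simp add: basis_expansion scalar_mult_eq_scaleR[symmetric])
  then show ?thesis by (simp add: linear_sum[OF lin] linear_scale[OF lin] pderiv_at_def)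
qed

lemma square_add_le: "(x + y)\<^sup>2 \<le> 2 * x\<^sup>2 + 2 * (y::real)\<^sup>2"
  using sum_squares_bound[of x y] by (simp add: power2_sum)

section \<open>Gaussian law of Wiener integrals and integration by parts\<close>

context wiener_integral
begin

definition X_span :: "('a \<Rightarrow> real) set" where
  "X_span = {S. \<exists>J c. finite J \<and> J \<subseteq> {0..T} \<and> S = (\<lambda>\<omega>. \<Sum>t\<in>J. c t * X t \<omega>)}"

lemma X_in_span: "t \<in> {0..T} \<Longrightarrow> X t \<in> X_span"
  unfolding X_span_def by (intro CollectI exI[of _ "{t}"] exI[of _ "\<lambda>_. 1"]) auto

lemma X_span_lin:
  assumes "S \<in> X_span" "S' \<in> X_span"
  shows "(\<lambda>\<omega>. a * S \<omega> + b * S' \<omega>) \<in> X_span"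
proof -
  from assms obtain J c J' c' where J: "finite J" "J \<subseteq> {0..T}" "S = (\<lambda>\<omega>. \<Sum>t\<in>J. c t * X t \<omega>)"
    and J': "finite J'" "J' \<subseteq> {0..T}" "S' = (\<lambda>\<omega>. \<Sum>t\<in>J'. c' t * X t \<omega>)"
    by (auto simp: X_span_def)
  \<comment> \<open>The index sets may overlap, and the coefficients \<open>c\<close>,
    \<open>c'\<close> are arbitrary outside \<open>J\<close>, \<open>J'\<close>; hence the
    cut-offs.\<close>
  define d where "d t = a * (if t \<in> J then c t else 0) + b * (if t \<in> J' then c' t else 0)" for t
  have "a * S \<omega> + b * S' \<omega> = (\<Sum>t\<in>J \<union> J'. d t * X t \<omega>)" for \<omega>
  proof -
    have "S \<omega> = (\<Sum>t\<in>J \<union> J'. (if t \<in> J then c t else 0) * X t \<omega>)"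
      unfolding J(3) using J(1) J'(1) by (intro sum.mono_neutral_cong_left) auto
    moreover have "S' \<omega> = (\<Sum>t\<in>J \<union> J'. (if t \<in> J' then c' t else 0) * X t \<omega>)"
      unfolding J'(3) using J(1) J'(1) by (intro sum.mono_neutral_cong_left) auto
    ultimately show ?thesis
      by (simp only: d_def sum_distrib_left sum.distrib[symmetric] distrib_right mult.assoc)
  qed
  then show ?thesis
    using J J' unfolding X_span_def by (intro CollectI exI[of _ "J \<union> J'"] exI[of _ d]) auto
qed

lemma X_span_gaussian:
  assumes "S \<in> X_span"
  shows "gaussian_rv M S" "expectation S = 0"
proof -
  from assms obtain J c where J: "finite J" "J \<subseteq> {0..T}" and S: "S = (\<lambda>\<omega>. \<Sum>t\<in>J. c t * X t \<omega>)"
    by (auto simp: X_span_def)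
  have G: "gaussian_rv M (\<lambda>\<omega>. \<Sum>t\<in>J. c t * X t \<omega>)" if "finite J" "J \<subseteq> {0..T}" for J c
    using gaussian that by (auto simp: gaussian_process_def)
  show "gaussian_rv M S" unfolding S using J by (rule G)
  have "integrable M (X t)" if "t \<in> J" for t
    using gaussian_rv_integrable(1)[OF G[of "{t}" "\<lambda>_. 1"]] that J by auto
  then show "expectation S = 0"
    unfolding S using J mean_zero by (subst Bochner_Integration.integral_sum) (auto intro!: sum.neutral)
qed

lemma X_span_measurable [measurable]: "S \<in> X_span \<Longrightarrow> S \<in> borel_measurable M"
  using X_span_gaussian(1) by (simp add: gaussian_rv_def)

lemma W_diff_span_square_integrable:
  assumes "\<phi> \<in> L" "S \<in> X_span"
  shows "integrable M (\<lambda>\<omega>. (W \<phi> \<omega> - S \<omega>)\<^sup>2)"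
  using integrable_square_lin[of "W \<phi>" M S 1 "- 1"] assms
  by (simp add: W_square_integrable gaussian_rv_integrable(2) X_span_gaussian)



text \<open>Gaussianity is assumed for finite combinations of the X_t only, so every Wiener integral
  has to be reached from these. Approximability survives linear combinations and, by
  \<open>W_tendsto\<close>, dominated limits; the tolerance stays arbitrary because both steps
  divide it.\<close>

lemma W_approx_span:
  assumes "\<phi> \<in> L" "0 < e"
  shows "\<exists>S\<in>X_span. (\<integral>\<omega>. (W \<phi> \<omega> - S \<omega>)\<^sup>2 \<partial>M) < e"
  using assms
proof (induction arbitrary: e rule: L_space_induct)
  case (interval t)
  have "(\<integral>\<omega>. (W (indicator {0..t}) \<omega> - X t \<omega>)\<^sup>2 \<partial>M) = 0"
    using W_X[OF interval(1)] by (intro integral_eq_zero_AE) auto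
  then show ?case using X_in_span[OF interval(1)] interval(2) by force
next
  case (linear \<phi> \<psi> a b)
  \<comment> \<open>Since (x + y)^2 \<le> 2 x^2 + 2 y^2, the error of the combination is at most 2
    (a^2 + b^2) d, which lies below e. The summand 1 makes this strict and keeps the denominator
    positive when a = b = 0.\<close>
  define d where "d = e / (2 * (a\<^sup>2 + b\<^sup>2 + 1))"
  have pos: "0 < a\<^sup>2 + b\<^sup>2 + 1" by (simp add: add_nonneg_pos)
  then have d: "0 < d" using linear by (simp add: d_def)
  obtain S where S: "S \<in> X_span" "(\<integral>\<omega>. (W \<phi> \<omega> - S \<omega>)\<^sup>2 \<partial>M) < d" using linear(3)[OF d] by blast
  obtain S' where S': "S' \<in> X_span" "(\<integral>\<omega>. (W \<psi> \<omega> - S' \<omega>)\<^sup>2 \<partial>M) < d" using linear(4)[OF d] by blast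
  have lin: "(\<lambda>u. a * \<phi> u + b * \<psi> u) \<in> L" "(\<lambda>\<omega>. a * S \<omega> + b * S' \<omega>) \<in> X_span"
    using linear S S' by (auto intro: L_lin X_span_lin)
  note i = W_diff_span_square_integrable
  have "(\<integral>\<omega>. (W (\<lambda>u. a * \<phi> u + b * \<psi> u) \<omega> - (a * S \<omega> + b * S' \<omega>))\<^sup>2 \<partial>M)
     \<le> (\<integral>\<omega>. 2 * a\<^sup>2 * (W \<phi> \<omega> - S \<omega>)\<^sup>2 + 2 * b\<^sup>2 * (W \<psi> \<omega> - S' \<omega>)\<^sup>2 \<partial>M)"
  proof (rule integral_mono_AE)
    show "integrable M (\<lambda>\<omega>. (W (\<lambda>u. a * \<phi> u + b * \<psi> u) \<omega> - (a * S \<omega> + b * S' \<omega>))\<^sup>2)"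
      using lin by (rule i)
    show "integrable M (\<lambda>\<omega>. 2 * a\<^sup>2 * (W \<phi> \<omega> - S \<omega>)\<^sup>2 + 2 * b\<^sup>2 * (W \<psi> \<omega> - S' \<omega>)\<^sup>2)"
      using i[OF linear(1) S(1)] i[OF linear(2) S'(1)] by simp
    show "AE \<omega> in M. (W (\<lambda>u. a * \<phi> u + b * \<psi> u) \<omega> - (a * S \<omega> + b * S' \<omega>))\<^sup>2 
        \<le> 2 * a\<^sup>2 * (W \<phi> \<omega> - S \<omega>)\<^sup>2 + 2 * b\<^sup>2 * (W \<psi> \<omega> - S' \<omega>)\<^sup>2"
      using W_lin[OF linear(1,2), of a b]
    proof (rule AE_mp, intro AE_I2 impI)
      fix \<omega> assume "W (\<lambda>u. a * \<phi> u + b * \<psi> u) \<omega> = a * W \<phi> \<omega> + b * W \<psi> \<omega>"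
      then have "W (\<lambda>u. a * \<phi> u + b * \<psi> u) \<omega> - (a * S \<omega> + b * S' \<omega>) = a * (W \<phi> \<omega> - S \<omega>) + b * (W \<psi> \<omega> - S' \<omega>)"
        by (simp add: algebra_simps)
      then show "(W (\<lambda>u. a * \<phi> u + b * \<psi> u) \<omega> - (a * S \<omega> + b * S' \<omega>))\<^sup>2 
        \<le> 2 * a\<^sup>2 * (W \<phi> \<omega> - S \<omega>)\<^sup>2 + 2 * b\<^sup>2 * (W \<psi> \<omega> - S' \<omega>)\<^sup>2"
        using square_add_le[of "a * (W \<phi> \<omega> - S \<omega>)" "b * (W \<psi> \<omega> - S' \<omega>)"] by (simp add: power_mult_distrib)
    qed
  qed
  also have "\<dots> = 2 * a\<^sup>2 * (\<integral>\<omega>. (W \<phi> \<omega> - S \<omega>)\<^sup>2 \<partial>M) + 2 * b\<^sup>2 * (\<integral>\<omega>. (W \<psi> \<omega> - S' \<omega>)\<^sup>2 \<partial>M)"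
    using i[OF linear(1) S(1)] i[OF linear(2) S'(1)] by simp
  also have "\<dots> \<le> 2 * a\<^sup>2 * d + 2 * b\<^sup>2 * d"
    using S(2) S'(2) by (intro add_mono mult_left_mono) auto
  also have "\<dots> < 2 * (a\<^sup>2 + b\<^sup>2 + 1) * d" using d by (simp add: algebra_simps)
  also have "\<dots> = e" using pos by (simp add: d_def)
  finally show ?case using lin(2) by (intro bexI[of _ "\<lambda>\<omega>. a * S \<omega> + b * S' \<omega>"])
next
  case (limit \<phi> \<phi>' g)
  have "(\<lambda>n. \<integral>\<omega>. (W (\<phi> n) \<omega> - W \<phi>' \<omega>)\<^sup>2 \<partial>M) \<longlonglongrightarrow> 0"
    by (rule W_tendsto[OF limit(1-5)])
  \<comment> \<open>Two errors below e / 4, each doubled by the inequality for squares, add up to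
    less than e.\<close>
  from LIMSEQ_D[OF this, of "e / 4"] limit(7) 
  obtain n where "\<bar>\<integral>\<omega>. (W (\<phi> n) \<omega> - W \<phi>' \<omega>)\<^sup>2 \<partial>M\<bar> < e / 4" by auto
  then have n: "(\<integral>\<omega>. (W (\<phi> n) \<omega> - W \<phi>' \<omega>)\<^sup>2 \<partial>M) < e / 4" by linarith
  obtain S where S: "S \<in> X_span" "(\<integral>\<omega>. (W (\<phi> n) \<omega> - S \<omega>)\<^sup>2 \<partial>M) < e / 4"
    using limit(6)[of "e / 4"] limit(7) by auto
  have i: "integrable M (\<lambda>\<omega>. (W (\<phi> n) \<omega> - S \<omega>)\<^sup>2)" "integrable M (\<lambda>\<omega>. (W (\<phi> n) \<omega> - W \<phi>' \<omega>)\<^sup>2)"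
    "integrable M (\<lambda>\<omega>. (W \<phi>' \<omega> - S \<omega>)\<^sup>2)"
    using limit S by (auto intro: W_diff_span_square_integrable W_diff_square_integrable)
  have "(\<integral>\<omega>. (W \<phi>' \<omega> - S \<omega>)\<^sup>2 \<partial>M) \<le> (\<integral>\<omega>. 2 * (W (\<phi> n) \<omega> - S \<omega>)\<^sup>2 + 2 * (W (\<phi> n) \<omega> - W \<phi>' \<omega>)\<^sup>2 \<partial>M)"
  proof (rule integral_mono)
    fix \<omega>
    show "(W \<phi>' \<omega> - S \<omega>)\<^sup>2 \<le> 2 * (W (\<phi> n) \<omega> - S \<omega>)\<^sup>2 + 2 * (W (\<phi> n) \<omega> - W \<phi>' \<omega>)\<^sup>2"
      using square_add_le[of "W (\<phi> n) \<omega> - S \<omega>" "W \<phi>' \<omega> - W (\<phi> n) \<omega>"] by (simp add: power2_commute)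
  qed (use i in simp_all)
  also have "\<dots> = 2 * (\<integral>\<omega>. (W (\<phi> n) \<omega> - S \<omega>)\<^sup>2 \<partial>M) + 2 * (\<integral>\<omega>. (W (\<phi> n) \<omega> - W \<phi>' \<omega>)\<^sup>2 \<partial>M)"
    using i by simp
  also have "\<dots> < e" using n S(2) by simp
  finally show ?case using S(1) by blast
qed

text \<open>Centred Gaussian combinations S n converge to the Wiener integral in L^2. Their second
  moments converge to its second moment, which the isometry evaluates, and their characteristic
  functions converge too, so the Gaussian formula passes to the limit.\<close>

theorem W_char:
  assumes \<phi>: "\<phi> \<in> L"
  shows "(\<integral>\<omega>. iexp (W \<phi> \<omega>) \<partial>M) = complex_of_real (exp (- H_inner T \<mu> \<phi> \<phi> / 2))"
proof -
  have "\<exists>S\<in>X_span. (\<integral>\<omega>. (W \<phi> \<omega> - S \<omega>)\<^sup>2 \<partial>M) < inverse (real (Suc n))" for n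
    using \<phi> by (rule W_approx_span) simp
  then obtain S where S: "\<And>n. S n \<in> X_span" "\<And>n. (\<integral>\<omega>. (W \<phi> \<omega> - S n \<omega>)\<^sup>2 \<partial>M) < inverse (real (Suc n))"
    by metis
  have lim: "(\<lambda>n. \<integral>\<omega>. (W \<phi> \<omega> - S n \<omega>)\<^sup>2 \<partial>M) \<longlonglongrightarrow> 0"
    by (rule Lim_null_comparison[OF _ LIMSEQ_inverse_real_of_nat]) (use S(2) in \<open>auto intro!: always_eventually less_imp_le\<close>)
  have iW: "integrable M (\<lambda>\<omega>. (W \<phi> \<omega>)\<^sup>2)" by (rule W_square_integrable[OF \<phi>])
  have iD: "integrable M (\<lambda>\<omega>. (W \<phi> \<omega> - S n \<omega>)\<^sup>2)" for n by (rule W_diff_span_square_integrable[OF \<phi> S(1)])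
  have [measurable]: "W \<phi> \<in> borel_measurable M" "S n \<in> borel_measurable M" for n
    using \<phi> S(1) by auto
  have i1: "integrable M (\<lambda>\<omega>. (W \<phi> \<omega> - S n \<omega>) * W \<phi> \<omega>)" for n
    by (rule integral_Cauchy_Schwarz(1)) (simp_all add: iW iD)
  \<comment> \<open>Writing S n as W \<phi> - (W \<phi> - S n) leaves, besides the second moment of
    W \<phi>, only terms that vanish under L^2 convergence.\<close>
  have "(\<integral>\<omega>. (S n \<omega>)\<^sup>2 \<partial>M) = (\<integral>\<omega>. (W \<phi> \<omega>)\<^sup>2 \<partial>M) - 2 * (\<integral>\<omega>. (W \<phi> \<omega> - S n \<omega>) * W \<phi> \<omega> \<partial>M) 
      + (\<integral>\<omega>. (W \<phi> \<omega> - S n \<omega>)\<^sup>2 \<partial>M)" for n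
  proof -
    have "(S n \<omega>)\<^sup>2 = (W \<phi> \<omega>)\<^sup>2 - 2 * ((W \<phi> \<omega> - S n \<omega>) * W \<phi> \<omega>) + (W \<phi> \<omega> - S n \<omega>)\<^sup>2" for \<omega>
      by (simp add: power2_eq_square algebra_simps)
    then show ?thesis using iW iD[of n] i1[of n] by simp
  qed
  moreover have "(\<lambda>n. (\<integral>\<omega>. (W \<phi> \<omega>)\<^sup>2 \<partial>M) - 2 * (\<integral>\<omega>. (W \<phi> \<omega> - S n \<omega>) * W \<phi> \<omega> \<partial>M) 
      + (\<integral>\<omega>. (W \<phi> \<omega> - S n \<omega>)\<^sup>2 \<partial>M)) \<longlonglongrightarrow> (\<integral>\<omega>. (W \<phi> \<omega>)\<^sup>2 \<partial>M) - 2 * 0 + 0"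
    by (intro tendsto_intros lim L2_tendsto_inner iW iD) simp_all
  ultimately have "(\<lambda>n. \<integral>\<omega>. (S n \<omega>)\<^sup>2 \<partial>M) \<longlonglongrightarrow> H_inner T \<mu> \<phi> \<phi>"
    using W_isometry[OF \<phi> \<phi>] by (simp add: power2_eq_square)
  then have "(\<lambda>n. complex_of_real (exp (- (\<integral>\<omega>. (S n \<omega>)\<^sup>2 \<partial>M) / 2))) \<longlonglongrightarrow> complex_of_real (exp (- H_inner T \<mu> \<phi> \<phi> / 2))"
    by (intro tendsto_intros) simp_all
  then have 1: "(\<lambda>n. \<integral>\<omega>. iexp (S n \<omega>) \<partial>M) \<longlonglongrightarrow> complex_of_real (exp (- H_inner T \<mu> \<phi> \<phi> / 2))"
    using S(1) by (simp add: gaussian_rv_char X_span_gaussian)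
  have "(\<lambda>n. (\<integral>\<omega>. iexp (S n \<omega>) \<partial>M) - (\<integral>\<omega>. iexp (W \<phi> \<omega>) \<partial>M)) \<longlonglongrightarrow> 0"
  proof (rule Lim_null_comparison)
    show "(\<lambda>n. sqrt (\<integral>\<omega>. (W \<phi> \<omega> - S n \<omega>)\<^sup>2 \<partial>M)) \<longlonglongrightarrow> 0"
      using tendsto_real_sqrt[OF lim] by simp
    show "\<forall>\<^sub>F n in sequentially. cmod ((\<integral>\<omega>. iexp (S n \<omega>) \<partial>M) - (\<integral>\<omega>. iexp (W \<phi> \<omega>) \<partial>M)) \<le> sqrt (\<integral>\<omega>. (W \<phi> \<omega> - S n \<omega>)\<^sup>2 \<partial>M)"
    proof (intro always_eventually allI)
      fix n
      have i: "integrable M (\<lambda>\<omega>. iexp (S n \<omega>))" "integrable M (\<lambda>\<omega>. iexp (W \<phi> \<omega>))"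
        by (rule integrable_iexp; simp)+
      \<comment> \<open>Cauchy-Schwarz against the constant 1: on a probability space the L^1
        distance is at most the L^2 distance.\<close>
      have CS: "integrable M (\<lambda>\<omega>. (W \<phi> \<omega> - S n \<omega>) * 1)" 
        "(\<integral>\<omega>. \<bar>(W \<phi> \<omega> - S n \<omega>) * 1\<bar> \<partial>M) \<le> sqrt (\<integral>\<omega>. (W \<phi> \<omega> - S n \<omega>)\<^sup>2 \<partial>M) * sqrt (\<integral>\<omega>. 1\<^sup>2 \<partial>M)"
        by (rule integral_Cauchy_Schwarz; simp add: iD)+
      have "cmod ((\<integral>\<omega>. iexp (S n \<omega>) \<partial>M) - (\<integral>\<omega>. iexp (W \<phi> \<omega>) \<partial>M)) = cmod (\<integral>\<omega>. iexp (S n \<omega>) - iexp (W \<phi> \<omega>) \<partial>M)"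
        using i by simp
      also have "\<dots> \<le> (\<integral>\<omega>. cmod (iexp (S n \<omega>) - iexp (W \<phi> \<omega>)) \<partial>M)" by (rule integral_norm_bound)
      also have "\<dots> \<le> (\<integral>\<omega>. \<bar>W \<phi> \<omega> - S n \<omega>\<bar> \<partial>M)"
      proof (rule integral_mono)
        show "cmod (iexp (S n \<omega>) - iexp (W \<phi> \<omega>)) \<le> \<bar>W \<phi> \<omega> - S n \<omega>\<bar>" for \<omega>
          using norm_iexp_diff_le[of "S n \<omega>" "W \<phi> \<omega>"] by (simp only: abs_minus_commute)
      qed (use i CS(1) in \<open>auto intro!: integrable_norm\<close>)
      also have "\<dots> \<le> sqrt (\<integral>\<omega>. (W \<phi> \<omega> - S n \<omega>)\<^sup>2 \<partial>M)" using CS(2) by (simp add: prob_space)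
      finally show "cmod ((\<integral>\<omega>. iexp (S n \<omega>) \<partial>M) - (\<integral>\<omega>. iexp (W \<phi> \<omega>) \<partial>M)) \<le> sqrt (\<integral>\<omega>. (W \<phi> \<omega> - S n \<omega>)\<^sup>2 \<partial>M)" .
    qed
  qed
  then have "(\<lambda>n. \<integral>\<omega>. iexp (S n \<omega>) \<partial>M) \<longlonglongrightarrow> (\<integral>\<omega>. iexp (W \<phi> \<omega>) \<partial>M)" by (rule LIM_zero_cancel)
  from LIMSEQ_unique[OF this 1] show ?thesis .
qed

theorem cylindrical_integration_by_parts:
  fixes f :: "real^'n::finite \<Rightarrow> real"
  assumes h: "h \<in> L" and f: "f \<in> Cb_infinity" and \<phi>: "\<And>i. \<phi> i \<in> L"
  shows "(\<integral>\<omega>. H_inner T \<mu> (cyl_deriv W f \<phi> \<omega>) h \<partial>M) = (\<integral>\<omega>. cyl_rv W f \<phi> \<omega> * W h \<omega> \<partial>M)"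
proof -
  define Y where "Y \<omega> = (\<chi> i. W (\<phi> i) \<omega>)" for \<omega>
  define k where "k = (\<chi> i. H_inner T \<mu> (\<phi> i) h)"
  note D = Cb_infinity_derivatives[OF f]
  have Y[measurable]: "Y \<in> borel_measurable M" 
    using \<phi> by (subst borel_measurable_euclidean_space) (auto simp: Basis_vec_def Y_def inner_axis)
  have h_meas[measurable]: "W h \<in> borel_measurable M" using h by simp
  \<comment> \<open>For fixed \<omega> the partial derivatives are constants in \<open>u\<close>, so
    the form acts on the integrands alone; what remains is the derivative of \<open>f\<close> at
    \<open>Y \<omega>\<close> along \<open>k\<close>.\<close>
  have lhs: "H_inner T \<mu> (cyl_deriv W f \<phi> \<omega>) h = frechet_derivative f (at (Y \<omega>)) k" for \<omega>
    using \<phi> h unfolding cyl_deriv_def[abs_def] frechet_derivative_pderiv_at[OF D(1)] Y_def[symmetric]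
    by (subst H_inner_sum_left) (simp_all add: k_def mult.commute)
  have "(\<integral>\<omega>. f (Y \<omega>) * W h \<omega> \<partial>M) = (\<integral>\<omega>. frechet_derivative f (at (Y \<omega>)) k \<partial>M)"
  proof (cases "H_inner T \<mu> h h = 0")
    \<comment> \<open>A vanishing variance makes \<open>W h\<close> zero almost surely; the isometry
      then gives \<open>k = 0\<close>, and both sides are 0.\<close>
    case True
    then have "(\<integral>\<omega>. (W h \<omega>)\<^sup>2 \<partial>M) = 0" using W_isometry[OF h h] by (simp add: power2_eq_square)
    then have AE: "AE \<omega> in M. W h \<omega> = 0" 
      using integral_nonneg_eq_0_iff_AE[OF W_square_integrable[OF h]] by simp
    have "(\<integral>\<omega>. W (\<phi> i) \<omega> * W h \<omega> \<partial>M) = 0" for i using AE by (intro integral_eq_zero_AE) auto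
    then have "k = 0" using W_isometry[OF \<phi> h] by (simp add: k_def vec_eq_iff)
    moreover have "frechet_derivative f (at x) 0 = 0" for x
      using linear_frechet_derivative[OF D(1)] by (rule linear_0)
    moreover have "(\<integral>\<omega>. f (Y \<omega>) * W h \<omega> \<partial>M) = 0" using AE by (intro integral_eq_zero_AE) auto
    ultimately show ?thesis by simp
  next
    case False
    define \<sigma> where "\<sigma> = sqrt (H_inner T \<mu> h h)"
    have "H_inner T \<mu> h h = (\<integral>\<omega>. (W h \<omega>)\<^sup>2 \<partial>M)" using W_isometry[OF h h] by (simp add: power2_eq_square)
    then have "0 \<le> H_inner T \<mu> h h" by simp
    with False have \<sigma>: "0 < \<sigma>" "\<sigma>\<^sup>2 = H_inner T \<mu> h h" by (simp_all add: \<sigma>_def)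
    \<comment> \<open>The Wiener integral of \<open>\<Phi> t\<close> is almost surely t . Y, so the
      form on \<open>\<Phi> t\<close> supplies the covariance form \<open>Q\<close> of
      \<open>Y\<close>.\<close>
    define \<Phi> where "\<Phi> t u = (\<Sum>i\<in>UNIV. t $ i * \<phi> i u)" for t :: "real^'n" and u
    have \<Phi>: "\<Phi> t \<in> L" for t unfolding \<Phi>_def using \<phi> by (intro L_sum) simp_all
    have H\<Phi>: "H_inner T \<mu> (\<Phi> t) h = t \<bullet> k" for t
      unfolding \<Phi>_def using \<phi> h by (subst H_inner_sum_left) (simp_all add: k_def inner_vec_def)
    \<comment> \<open>Symmetry of the form is inherited, through the isometry, from the commuting
      product of Wiener integrals.\<close>
    have sym: "H_inner T \<mu> h (\<Phi> t) = t \<bullet> k" for t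
      using W_isometry[OF h \<Phi>] W_isometry[OF \<Phi> h] H\<Phi>[of t] by (simp add: mult.commute)
    have char: "(\<integral>\<omega>. iexp (t \<bullet> Y \<omega> + s * W h \<omega>) \<partial>M) 
      = complex_of_real (exp (- (H_inner T \<mu> (\<Phi> t) (\<Phi> t) + 2 * s * (t \<bullet> k) + s\<^sup>2 * \<sigma>\<^sup>2) / 2))" for t s
    proof -
      \<comment> \<open>By linearity any combination of the components of \<open>Y\<close> and
        \<open>W h\<close> is again a single Wiener integral, so \<open>W_char\<close> gives the
        joint characteristic function.\<close>
      define \<psi> where "\<psi> = (\<lambda>u. 1 * \<Phi> t u + s * h u)"
      have \<psi>: "\<psi> \<in> L" unfolding \<psi>_def by (intro L_lin \<Phi> h)
      have "AE \<omega> in M. W \<psi> \<omega> = t \<bullet> Y \<omega> + s * W h \<omega>"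
        using W_lin[OF \<Phi>[of t] h, of 1 s] W_sum[of UNIV \<phi> "($) t", OF _ \<phi>]
        by (auto simp: \<psi>_def \<Phi>_def[abs_def] Y_def inner_vec_def elim: AE_mp)
      then have "(\<integral>\<omega>. iexp (t \<bullet> Y \<omega> + s * W h \<omega>) \<partial>M) = (\<integral>\<omega>. iexp (W \<psi> \<omega>) \<partial>M)"
        using \<psi> by (intro integral_cong_AE) (auto elim: AE_mp)
      moreover have "H_inner T \<mu> \<psi> \<psi> = 1 * H_inner T \<mu> (\<Phi> t) \<psi> + s * H_inner T \<mu> h \<psi>"
        using H_inner_lin_left[OF \<Phi>[of t] h \<psi>, of 1 s] by (simp only: \<psi>_def[symmetric])
      moreover have "H_inner T \<mu> (\<Phi> t) \<psi> = 1 * H_inner T \<mu> (\<Phi> t) (\<Phi> t) + s * H_inner T \<mu> (\<Phi> t) h"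
        unfolding \<psi>_def by (intro H_inner_lin_right \<Phi> h)
      moreover have "H_inner T \<mu> h \<psi> = 1 * H_inner T \<mu> h (\<Phi> t) + s * H_inner T \<mu> h h"
        unfolding \<psi>_def by (intro H_inner_lin_right \<Phi> h)
      ultimately have "H_inner T \<mu> \<psi> \<psi> = H_inner T \<mu> (\<Phi> t) (\<Phi> t) + 2 * s * (t \<bullet> k) + s\<^sup>2 * \<sigma>\<^sup>2"
        by (simp add: \<sigma>(2) H\<Phi> sym power2_eq_square[of s] algebra_simps)
      then show ?thesis
        using W_char[OF \<psi>] \<open>(\<integral>\<omega>. iexp (t \<bullet> Y \<omega> + s * W h \<omega>) \<partial>M) = (\<integral>\<omega>. iexp (W \<psi> \<omega>) \<partial>M)\<close> by simp
    qed
    obtain B where B: "\<And>x. \<bar>f x\<bar> \<le> B" using D(2) by (auto simp: bounded_iff)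
    have "\<forall>i. \<exists>b. \<forall>x. \<bar>pderiv_at i f x\<bar> \<le> b" using D(4) by (auto simp: bounded_iff)
    then obtain b where b: "\<And>i x. \<bar>pderiv_at i f x\<bar> \<le> b i" by metis
    have b': "\<bar>frechet_derivative f (at x) k\<bar> \<le> (\<Sum>i\<in>UNIV. \<bar>k $ i\<bar> * b i)" for x
      unfolding frechet_derivative_pderiv_at[OF D(1)] using b
      by (intro order_trans[OF sum_abs] sum_mono) (simp add: abs_mult mult_left_mono)
    show ?thesis
    proof (rule gaussian_integration_by_parts[OF Y h_meas \<sigma>(1) char])
      show "H_inner T \<mu> (\<Phi> 0) (\<Phi> 0) = 0" by (simp add: \<Phi>_def[abs_def] H_inner_zero_left)
      show "(f has_derivative frechet_derivative f (at x)) (at x)" for x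
        using D(1) frechet_derivative_works by blast
      show "isCont (\<lambda>x. frechet_derivative f (at x) k) x" for x
        unfolding frechet_derivative_pderiv_at[OF D(1)]
        by (intro continuous_intros differentiable_imp_continuous_within D(3))
      show "\<bar>f x\<bar> \<le> max B (\<Sum>i\<in>UNIV. \<bar>k $ i\<bar> * b i)" for x
        using B[of x] by (simp add: le_max_iff_disj)
      show "\<bar>frechet_derivative f (at x) k\<bar> \<le> max B (\<Sum>i\<in>UNIV. \<bar>k $ i\<bar> * b i)" for x
        using b'[of x] by (simp add: le_max_iff_disj)
    qed
  qed
  then show ?thesis by (simp add: lhs cyl_rv_def Y_def)
qed

end

theorem lemma6p7:
  fixes M :: "'a measure" and T :: real and X :: "real \<Rightarrow> 'a \<Rightarrow> real"
    and \<mu> :: "(real \<times> real) set \<Rightarrow> ereal"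
    and W :: "(real \<Rightarrow> real) \<Rightarrow> 'a \<Rightarrow> real"
    and h :: "real \<Rightarrow> real"
    and f :: "real^'n::finite \<Rightarrow> real" and \<phi> :: "'n \<Rightarrow> real \<Rightarrow> real"
    and F :: "'a \<Rightarrow> real" and DF :: "'a \<Rightarrow> real \<Rightarrow> real"
  assumes "prob_space M" and "T > 0"
    and "gaussian_process M {0..T} X"
    and "\<And>t. t \<in> {0..T} \<Longrightarrow> integral\<^sup>L M (X t) = 0"
    and "\<And>\<omega>. \<omega> \<in> space M \<Longrightarrow> continuous_on {0..T} (\<lambda>t. X t \<omega>)"
    and "\<And>\<omega>. \<omega> \<in> space M \<Longrightarrow> X 0 \<omega> = 0"
    and "full_support_C0 M T X"
    and "is_covariance_measure M T X \<mu>"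
    and "L_space_linear T \<mu>"
    and "is_wiener_integral M T X \<mu> W"
    and "h \<in> L_space T \<mu>"
    and "f \<in> Cb_infinity" and "\<And>i. \<phi> i \<in> L_space T \<mu>"
    and "F = cyl_rv W f \<phi>" and "DF = cyl_deriv W f \<phi>"
  shows "integral\<^sup>L M (\<lambda>\<omega>. H_inner T \<mu> (DF \<omega>) h) = integral\<^sup>L M (\<lambda>\<omega>. F \<omega> * W h \<omega>)"
proof -
  interpret prob_space M by fact
  \<comment> \<open>For s = t = T the rectangle is the whole square, so the \<sigma>-finite measure
    \<mu> has a real value there and is in fact finite.\<close>
  have "\<mu> ({0..T} \<times> {0..T}) = ereal (covariance M (X T) (X T))"
    using assms(2,8) by (simp add: is_covariance_measure_def)
  moreover have "signed_measure (square_borel T) \<mu>"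
    using assms(8) by (simp add: is_covariance_measure_def sigma_finite_signed_measure_def)
  ultimately interpret finite_signed_measure "square_borel T" \<mu>
    by unfold_locales (simp_all add: space_restrict_space)
  interpret wiener_integral M T X \<mu> W
    using assms by unfold_locales auto
  show ?thesis
    using cylindrical_integration_by_parts[of h f \<phi>] assms by simp
qed

end
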